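(* Let $\mathbb{G}=(\mathbb{R}^{m+n},\cdot,\delta_\lambda)$ be a Carnot group of step $2$ with complementary subgroups $\mathbb{V}=\{(x_1,0,\dots,0)\}$ and $\mathbb{W}=\{(0,x_2,\dots,x_m,y_1,\dots,y_n)\}$. Let $\hat{\mathcal O}\subset\mathbb{W}$ be open, let $\hat\phi:\hat{\mathcal O}\to\mathbb{V}$ be a locally intrinsic Lipschitz function, and let $\phi:\mathcal O\to\mathbb{R}$ be the real-valued function associated to $\hat\phi$. If $(D^\phi_2\phi,\dots,D^\phi_m\phi)\in \mathcal{L}^\infty_{loc}(\mathcal O,\mathbb{R}^{m-1})$ (the intrinsic gradient, which exists almost everywhere), then there is $w\in\mathcal{L}^\infty_{loc}(\mathcal O,\mathbb{R}^{m-1})$ with $w(a)=(D^\phi_2\phi(a),\dots,D^\phi_m\phi(a))$ for $\mathcal{L}^{m+n-1}$-a.e. $a\in\mathcal O$ such that $\phi$ is a distributional solution in $\mathcal O$ of $$(D^\phi_2\phi,\dots,D^\phi_m\phi)=w .$$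
   Context: Group. $\mathcal B^{(s)}=(b^{(s)}_{jl})_{j,l=1}^m$, $s=1,\dots,n$, are linearly independent skew-symmetric real $m\times m$ matrices. $\mathbb{G}=\mathbb{R}^{m+n}$, with points $p=(p^1,p^2)\in\mathbb{R}^m\times\mathbb{R}^n$ also written $(x_1,\dots,x_m,y_1,\dots,y_n)$, has the product $p\cdot q=(p^1+q^1,\,p^2+q^2+\tfrac12\langle\mathcal Bp^1,q^1\rangle)$, $\langle\mathcal Bp^1,q^1\rangle=(\langle\mathcal B^{(1)}p^1,q^1\rangle,\dots,\langle\mathcal B^{(n)}p^1,q^1\rangle)$, and dilations $\delta_\lambda p=(\lambda p^1,\lambda^2p^2)$. The homogeneous norm is $\|p\|=\max\{|p^1|,\epsilon|p^2|^{1/2}\}$ with $\epsilon\in(0,1]$ fixed so that $\|p\cdot q\|\le\|p\|+\|q\|$. Each $p\in\mathbb{G}$ is uniquely $p=p_{\mathbb W}\cdot p_{\mathbb V}$ with $p_{\mathbb W}\in\mathbb W$, $p_{\mathbb V}\in\mathbb V$. Let $i:\mathbb{R}^{m+n-1}\to\mathbb W$, $i(x_2,\dots,x_m,y_1,\dots,y_n)=(0,x_2,\dots,x_m,y_1,\dots,y_n)$. Given $\hat\phi:\hat{\mathcal O}\to\mathbb V$, put $\mathcal O=i^{-1}(\hat{\mathcal O})$, and $\phi:\mathcal O\to\mathbb R$ is defined by $\hat\phi(i(a))=(\phi(a),0,\dots,0)$. The intrinsic graph is $\mathrm{graph}(\hat\phi)=\{a\cdot\hat\phi(a):a\in\hat{\mathcal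 O}\}$. Intrinsic Lipschitz. For $\beta\ge0$, $q\in\mathbb G$ let $C_{\mathbb W,\mathbb V}(q,\beta)=q\cdot\{p:\|p_{\mathbb W}\|\le\beta\|p_{\mathbb V}\|\}$. $\hat\phi$ is intrinsic $C_L$-Lipschitz ($C_L\ge 0$) if for all $C_1>C_L$ and all $p\in\mathrm{graph}(\hat\phi)$, $C_{\mathbb W,\mathbb V}(p,1/C_1)\cap\mathrm{graph}(\hat\phi)=\{p\}$; it is intrinsic Lipschitz if this holds for some $C_L$, and locally intrinsic Lipschitz if every point of $\hat{\mathcal O}$ has a neighbourhood on which the restriction of $\hat\phi$ is intrinsic Lipschitz. Intrinsic gradient. A map $\ell:\mathbb W\to\mathbb V$ is intrinsic linear if its intrinsic graph is a homogeneous subgroup (a subgroup closed under all $\delta_\lambda$); these are the maps $\ell(0,x_2,\dots,x_m,y)=(\sum_{j=2}^m c_jx_j,0,\dots,0)$. For $a\in\hat{\mathcal O}$ and $p=a\cdot\hat\phi(a)$, let $\hat\phi_{p^{-1}}$ be the function whose intrinsic graph is $p^{-1}\cdot\mathrm{graph}(\hat\phi)$. $\hat\phi$ is intrinsic differentiable at $a$ if there is an intrinsic linear $\ell$ with $\lim_{r\to0^+}\sup_{0<\|b\|<r}\|\ell(b)^{-1}\hat\phi_{p^{-1}}(b)\|/\|b\|=0$; the coefficients $(c_2,\dots,c_m)$ of this unique $\ell$ form the intrinsic gradient $\nabla^{\hat\phi}\hat\phi(a)$, and for $a=i(a')$ are also written $(D_2^\phi\phi(a'),\dots,D_m^\phi\phi(a'))$.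 A locally intrinsic Lipschitz $\hat\phi$ is intrinsic differentiable at almost every point (known Rademacher-type theorem), so the intrinsic gradient is defined a.e. Distributional solution. On functions on $\mathcal O$ let $X_j=\partial_{x_j}+\tfrac12\sum_{s=1}^n\sum_{l=2}^m b_{jl}^{(s)}x_l\,\partial_{y_s}$ for $j=2,\dots,m$ and $Y_s=\partial_{y_s}$. For $w=(w_2,\dots,w_m)\in\mathcal L^\infty_{loc}(\mathcal O,\mathbb R^{m-1})$, a continuous $\phi:\mathcal O\to\mathbb R$ is a distributional solution of $(D_2^\phi\phi,\dots,D_m^\phi\phi)=w$ in $\mathcal O$ if for all $\zeta\in C^1_c(\mathcal O,\mathbb R)$ and $j=2,\dots,m$, $$\int_{\mathcal O}\phi\Big(X_j\zeta+\tfrac12\phi\sum_{s=1}^n b_{j1}^{(s)}Y_s\zeta\Big)d\mathcal L^{m+n-1}=-\int_{\mathcal O}w_j\zeta\,d\mathcal L^{m+n-1}.$$ *)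

theory Defs
  imports "HOL-Analysis.Analysis"
begin

text \<open>
  The index set \<open>{1, ..., m}\<close> of the first layer is the type \<^typ>\<open>'k option\<close>: \<^term>\<open>None\<close> is the
  index 1, and \<open>Some j\<close> runs through the indices \<open>2, ..., m\<close>, so that \<open>m = CARD('k) + 1\<close> (a skew
  \<open>1 \<times> 1\<close> matrix vanishes, so \<open>m \<ge> 2\<close> for every Carnot group of step 2). The indices
  \<open>1, ..., n\<close> of the second layer are the type \<^typ>\<open>'n\<close>.
\<close>

type_synonym ('k, 'n) carnot = "(real ^ 'k option) \<times> (real ^ 'n)"
type_synonym ('k, 'n) matrices = "'n \<Rightarrow> real ^ 'k option ^ 'k option"

definition carnot_step2 :: "('k::finite, 'n::finite) matrices \<Rightarrow> bool" where
  "carnot_step2 B \<longleftrightarrow>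
     (\<forall>s. transpose (B s) = - B s) \<and> inj B \<and> independent (range B)"

definition gmul ::
  "('k::finite, 'n::finite) matrices \<Rightarrow> ('k, 'n) carnot \<Rightarrow> ('k, 'n) carnot \<Rightarrow> ('k, 'n) carnot" where
  "gmul B p q =
     (fst p + fst q, snd p + snd q + (1/2) *\<^sub>R (\<chi> s. (B s *v fst p) \<bullet> fst q))"

text \<open>By skew-symmetry the group inverse is the additive one, see \<open>gmul_ginv\<close>.\<close>

definition ginv :: "('k::finite, 'n::finite) carnot \<Rightarrow> ('k, 'n) carnot" where
  "ginv p = (- fst p, - snd p)"

definition dil :: "real \<Rightarrow> ('k::finite, 'n::finite) carnot \<Rightarrow> ('k, 'n) carnot" where
  "dil r p = (r *\<^sub>R fst p, r\<^sup>2 *\<^sub>R snd p)"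

definition hnorm :: "real \<Rightarrow> ('k::finite, 'n::finite) carnot \<Rightarrow> real" where
  "hnorm eps p = max (norm (fst p)) (eps * sqrt (norm (snd p)))"

definition subV :: "('k::finite, 'n::finite) carnot set" where
  "subV = {p. (\<forall>j. fst p $ Some j = 0) \<and> snd p = 0}"

definition subW :: "('k::finite, 'n::finite) carnot set" where
  "subW = {p. fst p $ None = 0}"

definition embV :: "real \<Rightarrow> ('k::finite, 'n::finite) carnot" where
  "embV t = (axis None t, 0)"

definition embW :: "(real ^ 'k) \<times> (real ^ 'n) \<Rightarrow> ('k::finite, 'n::finite) carnot" where
  "embW a = (\<chi> i. case i of None \<Rightarrow> 0 | Some j \<Rightarrow> fst a $ j, snd a)"

text \<open>The definite descriptions are justified by \<open>decomposition_unique\<close> below.\<close>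

definition projW ::
  "('k::finite, 'n::finite) matrices \<Rightarrow> ('k, 'n) carnot \<Rightarrow> ('k, 'n) carnot" where
  "projW B p = (THE w. w \<in> subW \<and> (\<exists>v\<in>subV. p = gmul B w v))"

definition projV ::
  "('k::finite, 'n::finite) matrices \<Rightarrow> ('k, 'n) carnot \<Rightarrow> ('k, 'n) carnot" where
  "projV B p = (THE v. v \<in> subV \<and> (\<exists>w\<in>subW. p = gmul B w v))"

definition igraph ::
  "('k::finite, 'n::finite) matrices \<Rightarrow> ('k, 'n) carnot set
     \<Rightarrow> (('k, 'n) carnot \<Rightarrow> ('k, 'n) carnot) \<Rightarrow> ('k, 'n) carnot set" where
  "igraph B U f = (\<lambda>a. gmul B a (f a)) ` U"

definition icone ::
  "real \<Rightarrow> ('k::finite, 'n::finite) matrices \<Rightarrow> ('k, 'n) carnot \<Rightarrow> real \<Rightarrow> ('k, 'n) carnot set" where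
  "icone eps B q \<beta> = gmul B q ` {p. hnorm eps (projW B p) \<le> \<beta> * hnorm eps (projV B p)}"

definition intrinsic_lipschitz_with ::
  "real \<Rightarrow> ('k::finite, 'n::finite) matrices \<Rightarrow> real \<Rightarrow> ('k, 'n) carnot set
     \<Rightarrow> (('k, 'n) carnot \<Rightarrow> ('k, 'n) carnot) \<Rightarrow> bool" where
  "intrinsic_lipschitz_with eps B C U f \<longleftrightarrow>
     C \<ge> 0 \<and> (\<forall>C1>C. \<forall>p\<in>igraph B U f. icone eps B p (1 / C1) \<inter> igraph B U f = {p})"

definition locally_intrinsic_lipschitz ::
  "real \<Rightarrow> ('k::finite, 'n::finite) matrices \<Rightarrow> ('k, 'n) carnot set
     \<Rightarrow> (('k, 'n) carnot \<Rightarrow> ('k, 'n) carnot) \<Rightarrow> bool" where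
  "locally_intrinsic_lipschitz eps B U f \<longleftrightarrow>
     (\<forall>a\<in>U. \<exists>N. openin (top_of_set U) N \<and> a \<in> N \<and> (\<exists>C. intrinsic_lipschitz_with eps B C N f))"

definition homogeneous_subgroup ::
  "('k::finite, 'n::finite) matrices \<Rightarrow> ('k, 'n) carnot set \<Rightarrow> bool" where
  "homogeneous_subgroup B S \<longleftrightarrow>
     0 \<in> S \<and> (\<forall>p\<in>S. \<forall>q\<in>S. gmul B p q \<in> S) \<and> (\<forall>p\<in>S. ginv p \<in> S) \<and>
     (\<forall>r>0. \<forall>p\<in>S. dil r p \<in> S)"

definition intrinsic_linear ::
  "('k::finite, 'n::finite) matrices \<Rightarrow> (('k, 'n) carnot \<Rightarrow> ('k, 'n) carnot) \<Rightarrow> bool" where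
  "intrinsic_linear B l \<longleftrightarrow> l ` subW \<subseteq> subV \<and> homogeneous_subgroup B (igraph B subW l)"

text \<open>Domain and values of the function whose intrinsic graph is \<open>S\<close>.\<close>

definition graph_dom ::
  "('k::finite, 'n::finite) matrices \<Rightarrow> ('k, 'n) carnot set \<Rightarrow> ('k, 'n) carnot set" where
  "graph_dom B S = {b \<in> subW. \<exists>v\<in>subV. gmul B b v \<in> S}"

definition graph_fun ::
  "('k::finite, 'n::finite) matrices \<Rightarrow> ('k, 'n) carnot set \<Rightarrow> ('k, 'n) carnot \<Rightarrow> ('k, 'n) carnot"
  where
  "graph_fun B S b = (THE v. v \<in> subV \<and> gmul B b v \<in> S)"

text \<open>
  The supremum is taken in \<^typ>\<open>ennreal\<close>, so that it is meaningful when the quotient is unbounded;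
  \<open>b\<close> ranges over the domain of the translated function, which for relatively open \<open>U\<close> contains
  all points of \<^const>\<open>subW\<close> of small norm.
\<close>

definition intrinsic_differential ::
  "real \<Rightarrow> ('k::finite, 'n::finite) matrices \<Rightarrow> ('k, 'n) carnot set
     \<Rightarrow> (('k, 'n) carnot \<Rightarrow> ('k, 'n) carnot) \<Rightarrow> ('k, 'n) carnot
     \<Rightarrow> (('k, 'n) carnot \<Rightarrow> ('k, 'n) carnot) \<Rightarrow> bool" where
  "intrinsic_differential eps B U f a l \<longleftrightarrow>
     a \<in> U \<and> intrinsic_linear B l \<and>
     (let S = gmul B (ginv (gmul B a (f a))) ` igraph B U f in
       ((\<lambda>r. SUP b\<in>{b \<in> graph_dom B S. 0 < hnorm eps b \<and> hnorm eps b < r}.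
            ennreal (hnorm eps (gmul B (ginv (l b)) (graph_fun B S b)) / hnorm eps b))
         \<longlongrightarrow> 0) (at_right 0))"

text \<open>\<^term>\<open>None\<close> where the function is not intrinsic differentiable.\<close>

definition intrinsic_gradient ::
  "real \<Rightarrow> ('k::finite, 'n::finite) matrices \<Rightarrow> ('k, 'n) carnot set
     \<Rightarrow> (('k, 'n) carnot \<Rightarrow> ('k, 'n) carnot) \<Rightarrow> ('k, 'n) carnot \<Rightarrow> (real ^ 'k) option" where
  "intrinsic_gradient eps B U f a =
     (if \<exists>l. intrinsic_differential eps B U f a l
      then Some (THE c. \<exists>l. intrinsic_differential eps B U f a l \<and>
                            (\<forall>x y. l (embW (x, y)) = embV (\<Sum>j\<in>UNIV. c $ j * x $ j)))
      else None)"

definition Linf_loc :: "'a::euclidean_space set \<Rightarrow> ('a \<Rightarrow> 'b::euclidean_space) \<Rightarrow> bool" where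
  "Linf_loc U w \<longleftrightarrow>
     w \<in> borel_measurable (lebesgue_on U) \<and>
     (\<forall>K. compact K \<and> K \<subseteq> U \<longrightarrow> (\<exists>M. AE a in lebesgue_on U. a \<in> K \<longrightarrow> norm (w a) \<le> M))"

text \<open>Membership in \<open>L\<^sup>\<infinity>\<^sub>l\<^sub>o\<^sub>c\<close> of a function \<open>F\<close> that is only defined almost everywhere: \<open>F\<close> is
  defined a.e., and its a.e. class has a measurable, locally essentially bounded representative.\<close>

definition Linf_loc_ae :: "'a::euclidean_space set \<Rightarrow> ('a \<Rightarrow> 'b::euclidean_space option) \<Rightarrow> bool" where
  "Linf_loc_ae U F \<longleftrightarrow> (\<exists>g. Linf_loc U g \<and> (AE a in lebesgue_on U. F a = Some (g a)))"

text \<open>\<open>C\<^sup>1\<^sub>c(U)\<close>, the functions being extended by 0 to the whole space.\<close>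

definition C1c :: "'a::euclidean_space set \<Rightarrow> ('a \<Rightarrow> real) set" where
  "C1c U = {\<zeta>. (\<forall>a. \<zeta> differentiable (at a)) \<and>
               (\<forall>v. continuous_on UNIV (\<lambda>a. frechet_derivative \<zeta> (at a) v)) \<and>
               compact (closure {a. \<zeta> a \<noteq> 0}) \<and> closure {a. \<zeta> a \<noteq> 0} \<subseteq> U}"

definition Yop ::
  "'n \<Rightarrow> ((real ^ 'k) \<times> (real ^ 'n) \<Rightarrow> real) \<Rightarrow> (real ^ 'k::finite) \<times> (real ^ 'n::finite) \<Rightarrow> real" where
  "Yop s \<zeta> a = frechet_derivative \<zeta> (at a) (0, axis s 1)"

definition Xop ::
  "('k::finite, 'n::finite) matrices \<Rightarrow> 'k \<Rightarrow> ((real ^ 'k) \<times> (real ^ 'n) \<Rightarrow> real)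
     \<Rightarrow> (real ^ 'k) \<times> (real ^ 'n) \<Rightarrow> real" where
  "Xop B j \<zeta> a =
     frechet_derivative \<zeta> (at a) (axis j 1, 0) +
     (1/2) * (\<Sum>s\<in>UNIV. \<Sum>l\<in>UNIV. B s $ Some j $ Some l * fst a $ l * Yop s \<zeta> a)"

definition distributional_solution ::
  "('k::finite, 'n::finite) matrices \<Rightarrow> ((real ^ 'k) \<times> (real ^ 'n)) set
     \<Rightarrow> ((real ^ 'k) \<times> (real ^ 'n) \<Rightarrow> real) \<Rightarrow> ((real ^ 'k) \<times> (real ^ 'n) \<Rightarrow> real ^ 'k) \<Rightarrow> bool" where
  "distributional_solution B U \<phi> w \<longleftrightarrow>
     Linf_loc U w \<and> continuous_on U \<phi> \<and>
     (\<forall>\<zeta>\<in>C1c U. \<forall>j.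
        (LINT a|lebesgue_on U.
           \<phi> a * (Xop B j \<zeta> a + (1/2) * \<phi> a * (\<Sum>s\<in>UNIV. B s $ Some j $ None * Yop s \<zeta> a)))
        = - (LINT a|lebesgue_on U. w a $ j * \<zeta> a))"

lemma gmul_ginv:
  fixes B :: "('k::finite, 'n::finite) matrices"
  assumes "carnot_step2 B"
  shows "gmul B p (ginv p) = 0" "gmul B (ginv p) p = 0"
proof -
  have skew: "B s $ i $ j = - B s $ j $ i" for s i j
  proof -
    have "transpose (B s) $ i $ j = (- B s) $ i $ j"
      using assms by (simp add: carnot_step2_def)
    then show ?thesis by (simp add: transpose_def)
  qed
  have sk: "(B s *v x) \<bullet> x = 0" for s and x :: "real ^ 'k option"
  proof -
    have "(B s *v x) \<bullet> x = (\<Sum>i\<in>UNIV. \<Sum>j\<in>UNIV. B s $ i $ j * x $ j * x $ i)"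
      by (simp add: inner_vec_def matrix_vector_mult_def sum_distrib_right)
    also have "\<dots> = (\<Sum>i\<in>UNIV. \<Sum>j\<in>UNIV. B s $ j $ i * x $ i * x $ j)"
      by (rule sum.swap)
    also have "\<dots> = (\<Sum>i\<in>UNIV. \<Sum>j\<in>UNIV. - (B s $ i $ j * x $ j * x $ i))"
      proof (intro sum.cong refl)
      fix i j
      show "B s $ j $ i * x $ i * x $ j = - (B s $ i $ j * x $ j * x $ i)"
        using skew[of s j i] by simp
    qed
    also have "\<dots> = - (\<Sum>i\<in>UNIV. \<Sum>j\<in>UNIV. B s $ i $ j * x $ j * x $ i)"
      by (simp add: sum_negf)
    also have "\<dots> = - ((B s *v x) \<bullet> x)"
      by (simp add: inner_vec_def matrix_vector_mult_def sum_distrib_right)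
    finally show ?thesis by simp
  qed
  have neg: "B s *v (- x) = - (B s *v x)" for s x
    by (simp add: vec_eq_iff matrix_vector_mult_def sum_negf)
  show "gmul B p (ginv p) = 0" "gmul B (ginv p) p = 0"
    by (auto simp: gmul_def ginv_def prod_eq_iff vec_eq_iff[where 'b = 'n] sk neg)
qed

lemma decomposition_unique: "\<exists>!(w, v). w \<in> subW \<and> v \<in> subV \<and> p = gmul B w v"
proof -
  define v where "v = (embV (fst p $ None) :: ('a, 'b) carnot)"
  define w where "w = (fst p - fst v,
    snd p - (1/2) *\<^sub>R (\<chi> s. (B s *v (fst p - fst v)) \<bullet> fst v))"
  have ex: "w \<in> subW" "v \<in> subV" "p = gmul B w v"
    by (auto simp: w_def v_def subW_def subV_def embV_def gmul_def axis_def prod_eq_iff)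
  have uniq: "w' = w \<and> v' = v" if "w' \<in> subW" "v' \<in> subV" "p = gmul B w' v'" for w' v'
  proof -
    have "fst v' $ i = fst v $ i" for i
      using that by (cases i) (auto simp: v_def embV_def axis_def subW_def subV_def gmul_def)
    then have v: "v' = v"
      using that by (auto simp: prod_eq_iff vec_eq_iff subV_def v_def embV_def)
    then have "fst w' = fst p - fst v"
      using that by (simp add: gmul_def)
    moreover from this have "snd w' = snd w"
      using that v by (simp add: gmul_def w_def subV_def)
    ultimately show ?thesis
      using v by (simp add: prod_eq_iff w_def)
  qed
  show ?thesis
  proof (rule ex1I[of _ "(w, v)"])
    show "case (w, v) of (w, v) \<Rightarrow> w \<in> subW \<and> v \<in> subV \<and> p = gmul B w v"
      unfolding prod.case using ex by blast
    fix z assume "case z of (w, v) \<Rightarrow> w \<in> subW \<and> v \<in> subV \<and> p = gmul B w v"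
    then show "z = (w, v)"
      by (cases z) (use uniq in blast)
  qed
qed

end

theory Submission
  imports Defs
begin

text \<open>
  Write \<open>P(a; h, \<tau>)\<close> for the point reached from \<open>a\<close> by a step \<open>h\<close> along the vector field
  \<open>X\<^sub>j + \<phi>(a) v \<cdot> \<partial>\<^sub>y\<close>, where \<open>v\<close> has components \<open>b\<^sub>j\<^sub>1\<^sup>(\<^sup>s\<^sup>)\<close>, followed by a step \<open>\<tau>\<close> along the
  vertical vector \<open>v\<close>. In coordinates, the cone condition says
  \<open>|\<phi>(P(a; h, \<tau>)) - \<phi>(a)| \<le> C (|h| + |\<tau>|\<^sup>1\<^sup>/\<^sup>2)\<close> locally uniformly, and intrinsic
  differentiability at \<open>a\<close> says that \<open>\<phi>(P(a; h, \<tau>)) - \<phi>(a) - w\<^sub>j(a) h = o(|h| + |\<tau>|\<^sup>1\<^sup>/\<^sup>2)\<close>.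
  The claim is then that these two facts imply the balance law
  \<open>X\<^sub>j \<phi> + v \<cdot> \<partial>\<^sub>y (\<phi>\<^sup>2 / 2) = w\<^sub>j\<close> in the sense of distributions.

  The natural attempt is to integrate the difference quotients \<open>(\<phi>(P(a; h, 0)) - \<phi>(a)) / h\<close>
  against a test function and to change variables by \<open>a \<mapsto> P(a; h, 0)\<close>. This map is only
  1/2-Hoelder in the direction \<open>v\<close>, so it has no Jacobian. The remedy is to move along
  \<open>X\<^sub>j + u\<^sub>h v \<cdot> \<partial>\<^sub>y\<close> instead, where \<open>u\<^sub>h\<close> is the mean of \<open>\<phi>\<close> over the vertical segment of
  length \<open>h\<^sup>2\<close> in direction \<open>v\<close>. The scale \<open>h\<^sup>2\<close> is the right one: the vertical error that it
  causes is \<open>h (u\<^sub>h - \<phi>) = O(h\<^sup>2)\<close>, of the order which the intrinsic estimates tolerate, while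
  \<open>d\<^sub>h = \<partial>\<^sub>v u\<^sub>h = (\<phi>(a + h\<^sup>2 v) - \<phi>(a)) / h\<^sup>2\<close> is \<open>O(1/h)\<close>. At points of intrinsic
  differentiability both bounds improve, to \<open>u\<^sub>h - \<phi> = o(h)\<close> and \<open>h d\<^sub>h = o(1)\<close>, and
  this is what makes every commutator term vanish in the limit.

  Let \<open>F\<^sub>h(a)\<close> be the displaced point. Its Jacobian is \<open>1 + h d\<^sub>h\<close> and
  \<open>\<integral> (\<phi>\<zeta>)(F\<^sub>h(a)) (1 + h d\<^sub>h(a)) da = \<integral> \<phi>\<zeta>\<close> for every test function \<open>\<zeta>\<close>
  (\<open>integral_shear_displacement\<close>). This comes from \<open>\<integral> \<partial>\<^sub>v f = 0\<close>, applied to a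
  primitive along \<open>v\<close>, and so covers maps \<open>F\<^sub>h\<close> that fold lines over. Together with
  \<open>\<integral> u\<^sub>h d\<^sub>h \<zeta> = - \<integral> u\<^sub>h\<^sup>2 \<partial>\<^sub>v \<zeta> / 2\<close> it gives an identity \<open>\<integral> H\<^sub>h = 0\<close> whose
  integrands are bounded with support in a fixed compact set and converge almost everywhere to
  \<open>w\<^sub>j \<zeta> + \<phi> X\<^sub>j \<zeta> + \<phi>\<^sup>2 \<partial>\<^sub>v \<zeta> / 2\<close>. Dominated convergence finishes the proof
  (\<open>burgers_weak_form\<close>). What remains is the translation of the group-theoretic hypotheses
  (\<open>intrinsic_lipschitz_uniform_on_compact\<close>, \<open>intrinsic_differential_estimate\<close>,
  \<open>intrinsic_gradient_SomeD\<close>).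
\<close>

section \<open>Means and primitives along a line\<close>

text \<open>
  The mean of \<open>g\<close> over the segment from \<open>a\<close> to \<open>a + s v\<close>. Integrating over the unit
  interval makes the formula meaningful for every sign of \<open>s\<close> and also for \<open>s = 0\<close>.
\<close>

definition segment_mean :: "('a::euclidean_space \<Rightarrow> real) \<Rightarrow> 'a \<Rightarrow> real \<Rightarrow> 'a \<Rightarrow> real" where
  "segment_mean g v s a = integral {0..1} (\<lambda>\<sigma>. g (a + (\<sigma> * s) *\<^sub>R v))"

lemma continuous_segment_mean:
  assumes "continuous_on UNIV g" "continuous_on UNIV T" "continuous_on UNIV s"
  shows "continuous_on UNIV (\<lambda>a. segment_mean g v (s a) (T a))"
proof -
  have "continuous_on (UNIV \<times> cbox 0 1) (\<lambda>(a, \<sigma>). g (T a + (\<sigma> * s a) *\<^sub>R v))"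
    unfolding case_prod_unfold
    by (intro continuous_intros continuous_on_compose2[OF assms(1)]
        continuous_on_compose2[OF assms(2)] continuous_on_compose2[OF assms(3)]) auto
  from integral_continuous_on_param[OF this] show ?thesis
    unfolding segment_mean_def by simp
qed

lemma segment_continuous:
  fixes g :: "'a::euclidean_space \<Rightarrow> real"
  assumes "continuous_on UNIV g"
  shows "continuous_on S (\<lambda>\<sigma>. g (a + (\<sigma> * s) *\<^sub>R v))"
  by (intro continuous_on_compose2[OF assms] continuous_intros) auto

lemma segment_mean_close:
  assumes "continuous_on UNIV g" "\<And>\<sigma>. 0 \<le> \<sigma> \<Longrightarrow> \<sigma> \<le> 1 \<Longrightarrow> \<bar>g (a + (\<sigma> * s) *\<^sub>R v) - c\<bar> \<le> r"
  shows "\<bar>segment_mean g v s a - c\<bar> \<le> r"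
proof -
  let ?f = "\<lambda>\<sigma>. g (a + (\<sigma> * s) *\<^sub>R v)"
  have int: "?f integrable_on {0..1}"
    by (intro integrable_continuous_interval segment_continuous assms(1))
  have "segment_mean g v s a - c = integral {0..1} (\<lambda>\<sigma>. ?f \<sigma> - c)"
    unfolding segment_mean_def
    by (subst Henstock_Kurzweil_Integration.integral_diff[OF int]) auto
  also have "norm \<dots> \<le> r * (1 - 0)"
    by (rule integral_bound) (auto intro!: continuous_intros segment_continuous assms)
  finally show ?thesis by simp
qed

lemma segment_mean_eq_0:
  assumes "\<And>\<sigma>. 0 \<le> \<sigma> \<Longrightarrow> \<sigma> \<le> 1 \<Longrightarrow> g (a + (\<sigma> * s) *\<^sub>R v) = 0"
  shows "segment_mean g v s a = 0"
proof -
  have "integral {0..1} (\<lambda>\<sigma>. g (a + (\<sigma> * s) *\<^sub>R v)) = integral {0..1} (\<lambda>\<sigma>::real. 0::real)"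
    by (rule Henstock_Kurzweil_Integration.integral_cong) (use assms in auto)
  then show ?thesis by (simp add: segment_mean_def)
qed

text \<open>
  Parametrized by a primitive \<open>p\<close> of \<open>g\<close> along the line, the expression
  \<open>s * segment_mean g v s a\<close> is the signed integral of \<open>g\<close> over a segment. It thereby
  inherits joint continuity in \<open>(s, a)\<close> from the mean, and its derivatives from \<open>p\<close>.
\<close>

lemma line_antiderivative:
  assumes "continuous_on UNIV g"
  obtains p where "\<And>t. (p has_real_derivative g (a + t *\<^sub>R v)) (at t)"
    and "\<And>t s. s * segment_mean g v s (a + t *\<^sub>R v) = p (t + s) - p t"
proof -
  have "isCont (\<lambda>t. g (a + t *\<^sub>R v)) x" for x
    using segment_continuous[OF assms, of UNIV a 1 v] by (simp add: continuous_on_eq_continuous_at)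
  then obtain p where p: "\<And>t. (p has_real_derivative g (a + t *\<^sub>R v)) (at t)"
    using einterval_antiderivative[of "-\<infinity>" \<infinity> "\<lambda>t. g (a + t *\<^sub>R v)"]
    by (auto simp: has_real_derivative_iff_has_vector_derivative)
  have "s * segment_mean g v s (a + t *\<^sub>R v) = p (t + s) - p t" for t s
  proof -
    have "((\<lambda>\<sigma>. s * g (a + (t + \<sigma> * s) *\<^sub>R v)) has_integral (p (t + 1 * s) - p (t + 0 * s))) {0..1}"
    proof (rule fundamental_theorem_of_calculus)
      fix \<sigma> :: real
      have "((\<lambda>\<sigma>. p (t + \<sigma> * s)) has_real_derivative s * g (a + (t + \<sigma> * s) *\<^sub>R v)) (at \<sigma>)"
        by (rule DERIV_cong[OF DERIV_chain2[OF p]]) (auto intro!: derivative_eq_intros)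
      then show "((\<lambda>\<sigma>. p (t + \<sigma> * s)) has_vector_derivative s * g (a + (t + \<sigma> * s) *\<^sub>R v))
          (at \<sigma> within {0..1})"
        unfolding has_real_derivative_iff_has_vector_derivative[symmetric]
        by (rule has_field_derivative_at_within)
    qed simp
    then have "integral {0..1} (\<lambda>\<sigma>. s * g (a + (t + \<sigma> * s) *\<^sub>R v)) = p (t + s) - p t"
      by - (drule integral_unique, simp)
    moreover have "(\<lambda>\<sigma>. s * g (a + (t + \<sigma> * s) *\<^sub>R v)) =
        (\<lambda>\<sigma>. s * g (a + t *\<^sub>R v + (\<sigma> * s) *\<^sub>R v))"
      by (simp add: scaleR_add_left add.assoc)
    ultimately show ?thesis
      by (simp add: segment_mean_def)
  qed
  with p that show ?thesis by blast
qed

text \<open>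
  A mean over a segment is differentiable in the direction of the segment even when
  \<open>g\<close> is only continuous; the derivative is the difference quotient of \<open>g\<close>.
\<close>

lemma segment_mean_derivative:
  assumes "continuous_on UNIV g" "s \<noteq> 0"
  shows "((\<lambda>t. segment_mean g v s (a + t *\<^sub>R v)) has_real_derivative
    (g (a + s *\<^sub>R v) - g a) / s) (at 0)"
proof -
  obtain p where p: "\<And>t. (p has_real_derivative g (a + t *\<^sub>R v)) (at t)"
    and ps: "\<And>t s. s * segment_mean g v s (a + t *\<^sub>R v) = p (t + s) - p t"
    using line_antiderivative[OF assms(1)] by blast
  have "((\<lambda>t. (p (t + s) - p t) / s) has_real_derivative (g (a + s *\<^sub>R v) - g a) / s) (at 0)"
    using DERIV_shift[of p "g (a + s *\<^sub>R v)" 0 s] p[of s] p[of 0] assms(2)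
    by (auto intro!: derivative_eq_intros)
  moreover have "segment_mean g v s (a + t *\<^sub>R v) = (p (t + s) - p t) / s" for t
    using ps[of s t] assms(2) by (simp add: field_simps)
  ultimately show ?thesis by simp
qed

section \<open>Invariance of the integral under sheared displacements\<close>

lemma integral_translate:
  fixes f :: "'a::euclidean_space \<Rightarrow> real"
  assumes "f \<in> borel_measurable borel"
  shows "integral\<^sup>L lborel (\<lambda>a. f (a + c)) = integral\<^sup>L lborel f"
proof -
  have "integral\<^sup>L lborel f = integral\<^sup>L (distr lborel borel ((+) c)) f"
    by (simp add: lborel_distr_plus)
  also have "\<dots> = integral\<^sup>L lborel (\<lambda>a. f (a + c))"
    by (subst integral_distr) (use assms in \<open>auto simp: add.commute\<close>)
  finally show ?thesis by simp
qed

lemma nn_integral_translate: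
  fixes f :: "'a::euclidean_space \<Rightarrow> ennreal"
  assumes "f \<in> borel_measurable borel"
  shows "integral\<^sup>N lborel (\<lambda>a. f (a + c)) = integral\<^sup>N lborel f"
proof -
  have "integral\<^sup>N lborel f = integral\<^sup>N (distr lborel borel ((+) c)) f"
    by (simp add: lborel_distr_plus)
  also have "\<dots> = integral\<^sup>N lborel (\<lambda>a. f (a + c))"
    by (subst nn_integral_distr) (use assms in \<open>auto simp: add.commute\<close>)
  finally show ?thesis by simp
qed

lemma integrable_continuous_bounded_support:
  fixes f :: "'a::euclidean_space \<Rightarrow> real"
  assumes f: "continuous_on UNIV f" and S: "bounded {a. f a \<noteq> 0}"
  shows "integrable lborel f" and "\<exists>M. \<forall>a. \<bar>f a\<bar> \<le> M"
proof -
  let ?K = "closure {a. f a \<noteq> 0}"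
  have K: "compact ?K"
    using S by simp
  have "integrable lborel (\<lambda>a. indicator ?K a *\<^sub>R f a)"
    using borel_integrable_compact[OF K continuous_on_subset[OF f]] by auto
  also have "(\<lambda>a. indicator ?K a *\<^sub>R f a) = f"
    using closure_subset[of "{a. f a \<noteq> 0}"] by (auto simp: indicator_def fun_eq_iff)
  finally show "integrable lborel f" .
  have "compact (f ` ?K)"
    by (rule compact_continuous_image[OF continuous_on_subset[OF f] K]) auto
  then obtain M where M: "\<forall>x\<in>f ` ?K. norm x \<le> M"
    using compact_imp_bounded bounded_iff by blast
  have "\<bar>f a\<bar> \<le> max M 0" for a
    using M closure_subset[of "{a. f a \<noteq> 0}"] by (cases "f a = 0") (auto simp: le_max_iff_disj)
  then show "\<exists>M. \<forall>a. \<bar>f a\<bar> \<le> M" by blast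
qed

text \<open>
  The difference quotients of \<open>f\<close> have integral 0 by translation invariance, and
  by the mean value theorem they are dominated by the maximum of \<open>|f'|\<close> on a ball. Only the
  derivative in the one direction \<open>v\<close> is involved, which matters because the functions to which
  the lemma is applied are merely continuous in the other directions.
\<close>

lemma integral_directional_derivative_eq_0:
  fixes f :: "'a::euclidean_space \<Rightarrow> real"
  assumes f: "continuous_on UNIV f" and f': "continuous_on UNIV f'"
    and S: "bounded {a. f a \<noteq> 0}"
    and D: "\<And>a. ((\<lambda>t. f (a + t *\<^sub>R v)) has_real_derivative f' a) (at 0)"
  shows "integral\<^sup>L lborel f' = 0"
proof -
  have Dt: "((\<lambda>t. f (a + t *\<^sub>R v)) has_real_derivative f' (a + t *\<^sub>R v)) (at t)" for a t
  proof -
    have "((\<lambda>x. f (a + t *\<^sub>R v + x *\<^sub>R v)) has_real_derivative f' (a + t *\<^sub>R v)) (at 0)"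
      by (rule D)
    then have "((\<lambda>x. f (a + (x + t) *\<^sub>R v)) has_real_derivative f' (a + t *\<^sub>R v)) (at 0)"
      by (simp add: algebra_simps)
    then show ?thesis
      using DERIV_shift[of "\<lambda>x. f (a + x *\<^sub>R v)" "f' (a + t *\<^sub>R v)" 0 t] by simp
  qed
  obtain R where R: "\<And>a. f a \<noteq> 0 \<Longrightarrow> norm a \<le> R"
    using S by (auto simp: bounded_iff)
  define B where "B = cball (0::'a) (R + norm v)"
  have f'0: "f' a = 0" if "a \<notin> cball 0 R" for a
  proof (rule DERIV_unique[OF D])
    have "open (- cball 0 R :: 'a set)" by (rule open_Compl[OF closed_cball])
    moreover have "((\<lambda>t. a + t *\<^sub>R v) \<longlongrightarrow> a) (at 0)"
      by (auto intro!: tendsto_eq_intros)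
    ultimately have "\<forall>\<^sub>F t in at 0. a + t *\<^sub>R v \<in> - cball 0 R"
      using that by (auto dest!: topological_tendstoD)
    then have "\<forall>\<^sub>F t in nhds 0. a + t *\<^sub>R v \<in> - cball 0 R"
      using that by (auto simp: eventually_nhds_conv_at)
    then have "\<forall>\<^sub>F t in nhds 0. f (a + t *\<^sub>R v) = 0"
      by eventually_elim (use R in force)
    then show "((\<lambda>t. f (a + t *\<^sub>R v)) has_real_derivative 0) (at 0)"
      by (subst DERIV_cong_ev[of 0 0 _ "\<lambda>_. 0" 0 0]) auto
  qed
  have "bounded {a. f' a \<noteq> 0}"
    by (rule bounded_subset[OF bounded_cball[of 0 R]]) (use f'0 in force)
  from integrable_continuous_bounded_support(2)[OF f' this]
  obtain M where M: "\<And>a. \<bar>f' a\<bar> \<le> M" by blast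
  define h where "h n = 1 / real (Suc n)" for n
  have h: "0 < h n" "h n \<le> 1" for n
    by (auto simp: h_def divide_simps)
  have h0: "h \<longlonglongrightarrow> 0"
    unfolding h_def using LIMSEQ_inverse_real_of_nat by (simp add: inverse_eq_divide)
  have mf: "f \<in> borel_measurable borel"
    by (rule borel_measurable_continuous_onI[OF f])
  have mf': "f' \<in> borel_measurable borel"
    by (rule borel_measurable_continuous_onI[OF f'])
  define q where "q n a = (f (a + h n *\<^sub>R v) - f a) / h n" for n a
  have "(\<lambda>n. integral\<^sup>L lborel (q n)) \<longlonglongrightarrow> integral\<^sup>L lborel f'"
  proof (rule integral_dominated_convergence[where w = "\<lambda>a. M * indicator B a"])
    have "(\<lambda>a. a + h n *\<^sub>R v) \<in> borel_measurable borel" for n by measurable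
    then show "q n \<in> borel_measurable lborel" for n
      unfolding q_def using mf by measurable
    show "integrable lborel (\<lambda>a. M * indicator B a)"
      by (auto simp: B_def intro!: integrable_mult_right integrable_real_indicator
          emeasure_lborel_cball_finite)
    show "AE a in lborel. (\<lambda>n. q n a) \<longlonglongrightarrow> f' a"
    proof (rule AE_I2)
      fix a
      have "((\<lambda>t. (f (a + t *\<^sub>R v) - f a) / t) \<longlongrightarrow> f' a) (at 0)"
        using D[of a] by (simp add: has_field_derivative_iff)
      moreover have "filterlim h (at 0) sequentially"
        using h0 h(1) by (auto simp: filterlim_at intro!: always_eventually less_imp_neq[symmetric])
      ultimately show "(\<lambda>n. q n a) \<longlonglongrightarrow> f' a"
        unfolding q_def by (rule filterlim_compose)
    qed
    show "AE a in lborel. norm (q n a) \<le> M * indicator B a" for n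
    proof (rule AE_I2)
      fix a
      obtain z where z: "0 < z" "f (a + h n *\<^sub>R v) - f (a + 0 *\<^sub>R v) = (h n - 0) * f' (a + z *\<^sub>R v)"
        using MVT2[of 0 "h n" "\<lambda>t. f (a + t *\<^sub>R v)" "\<lambda>t. f' (a + t *\<^sub>R v)"] h Dt by blast
      then have qz: "q n a = f' (a + z *\<^sub>R v)"
        using h[of n] by (simp add: q_def)
      have "a \<in> B" if "q n a \<noteq> 0"
      proof -
        from that consider "f a \<noteq> 0" | "f (a + h n *\<^sub>R v) \<noteq> 0"
          by (cases "f a = 0") (auto simp: q_def)
        then show ?thesis
        proof cases
          case 1
          then show ?thesis using R[of a] norm_ge_zero[of v] by (simp add: B_def del: norm_ge_zero)
        next
          case 2
          have "norm a \<le> norm (a + h n *\<^sub>R v) + norm (h n *\<^sub>R v)"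
            using norm_triangle_ineq4[of "a + h n *\<^sub>R v" "h n *\<^sub>R v"] by simp
          also have "norm (h n *\<^sub>R v) \<le> norm v"
            using h[of n] by (simp add: mult_left_le_one_le)
          finally show ?thesis using R[OF 2] by (simp add: B_def)
        qed
      qed
      then show "norm (q n a) \<le> M * indicator B a"
        using M[of "a + z *\<^sub>R v"] qz by (cases "q n a = 0") (auto simp: indicator_def order_trans[OF abs_ge_zero M])
    qed
  qed (use mf' in auto)
  moreover have "integral\<^sup>L lborel (q n) = 0" for n
  proof -
    have int: "integrable lborel f"
      by (rule integrable_continuous_bounded_support[OF f S])
    have "continuous_on UNIV (\<lambda>a. f (a + h n *\<^sub>R v))"
      by (intro continuous_on_compose2[OF f] continuous_intros) auto
    moreover have "bounded {a. f (a + h n *\<^sub>R v) \<noteq> 0}"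
      unfolding bounded_iff
    proof (intro exI ballI)
      fix a assume "a \<in> {a. f (a + h n *\<^sub>R v) \<noteq> 0}"
      then show "norm a \<le> R + norm (h n *\<^sub>R v)"
        using R[of "a + h n *\<^sub>R v"] norm_triangle_ineq4[of "a + h n *\<^sub>R v" "h n *\<^sub>R v"] by simp
    qed
    ultimately have "integrable lborel (\<lambda>a. f (a + h n *\<^sub>R v))"
      by (rule integrable_continuous_bounded_support)
    then have "integral\<^sup>L lborel (q n) =
        (integral\<^sup>L lborel (\<lambda>a. f (a + h n *\<^sub>R v)) - integral\<^sup>L lborel f) / h n"
      unfolding q_def using int by simp
    then show ?thesis
      by (simp add: integral_translate[OF mf])
  qed
  ultimately show ?thesis
    by (simp add: LIMSEQ_const_iff)
qed

text \<open>
  The flow of \<open>X\<^sub>j\<close> is such a shear.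
\<close>

lemma distr_shear:
  fixes A :: "'a::euclidean_space \<Rightarrow> 'b::euclidean_space"
  assumes A: "continuous_on UNIV A"
  shows "distr lborel lborel (\<lambda>a. (fst a + e, snd a + A (fst a))) = (lborel :: ('a \<times> 'b) measure)"
proof (rule measure_eqI)
  let ?T = "\<lambda>a :: 'a \<times> 'b. (fst a + e, snd a + A (fst a))"
  have "continuous_on UNIV ?T"
    by (intro continuous_intros continuous_on_compose2[OF A]) auto
  then have T: "?T \<in> borel_measurable borel"
    by (rule borel_measurable_continuous_onI)
  interpret pair_sigma_finite lborel lborel ..
  fix S :: "('a \<times> 'b) set"
  assume "S \<in> sets (distr lborel lborel ?T)"
  then have S: "S \<in> sets borel" by simp
  have iS: "(\<lambda>a. indicator S a :: ennreal) \<in> borel_measurable (lborel \<Otimes>\<^sub>M lborel)"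
    using S by (simp add: lborel_prod)
  have iT: "(\<lambda>a. indicator S (?T a) :: ennreal) \<in> borel_measurable (lborel \<Otimes>\<^sub>M lborel)"
    using S T by (simp add: lborel_prod)
  have sect: "(\<lambda>y. indicator S (x, y) :: ennreal) \<in> borel_measurable borel" for x
    using measurable_compose_Pair1[OF _ iS, of x] by simp
  have sect2: "(\<lambda>x. \<integral>\<^sup>+y. indicator S (x, y) \<partial>lborel) \<in> borel_measurable borel"
    using lborel.borel_measurable_nn_integral_fst[OF iS] by simp
  have "emeasure (distr lborel lborel ?T) S = (\<integral>\<^sup>+a. indicator S a \<partial>distr lborel lborel ?T)"
    using S by simp
  also have "\<dots> = (\<integral>\<^sup>+a. indicator S (?T a) \<partial>lborel)"
    by (subst nn_integral_distr) (use S T in auto)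
  also have "\<dots> = (\<integral>\<^sup>+x. \<integral>\<^sup>+y. indicator S (x + e, y + A x) \<partial>lborel \<partial>lborel)"
    using lborel.nn_integral_fst[OF iT] by (simp add: lborel_prod)
  also have "\<dots> = (\<integral>\<^sup>+x. \<integral>\<^sup>+y. indicator S (x + e, y) \<partial>lborel \<partial>lborel)"
    by (subst nn_integral_translate[OF sect]) simp
  also have "\<dots> = (\<integral>\<^sup>+x. \<integral>\<^sup>+y. indicator S (x, y) \<partial>lborel \<partial>lborel)"
    by (rule nn_integral_translate[OF sect2])
  also have "\<dots> = (\<integral>\<^sup>+a. indicator S a \<partial>lborel)"
    using lborel.nn_integral_fst[OF iS] by (simp add: lborel_prod)
  finally show "emeasure (distr lborel lborel ?T) S = emeasure lborel S"
    using S by simp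
qed simp

text \<open>
  The factor \<open>1 + d a\<close> is the Jacobian of a displacement in direction \<open>v\<close> alone. A
  displacement that folds lines over is covered as well: the function \<open>f a\<close> that integrates \<open>g\<close> over the segment
  from the sheared point \<open>T a\<close> to \<open>T a + u a v\<close> has compact support, and its derivative
  in direction \<open>v\<close> is the difference of \<open>g\<close> at the two endpoints, weighted by their speeds
  \<open>1 + d a\<close> and \<open>1\<close>.
\<close>

lemma integral_shear_displacement:
  fixes g u d :: "'a::euclidean_space \<times> 'b::euclidean_space \<Rightarrow> real"
  assumes g: "continuous_on UNIV g" and bg: "bounded {a. g a \<noteq> 0}"
    and u: "continuous_on UNIV u" and M: "\<And>a. \<bar>u a\<bar> \<le> M"
    and d: "continuous_on UNIV d"
    and D: "\<And>a. ((\<lambda>t. u (a + t *\<^sub>R (0, v))) has_real_derivative d a) (at 0)"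
    and A: "bounded_linear A"
  shows "(\<integral>a. g ((fst a + e, snd a + A (fst a)) + u a *\<^sub>R (0, v)) * (1 + d a) \<partial>lborel) =
    integral\<^sup>L lborel g"
proof -
  let ?T = "\<lambda>a :: 'a \<times> 'b. (fst a + e, snd a + A (fst a))"
  let ?v = "(0, v) :: 'a \<times> 'b"
  have contA: "continuous_on UNIV A"
    using A by (rule linear_continuous_on)
  have T: "continuous_on UNIV ?T"
    by (intro continuous_intros continuous_on_compose2[OF contA]) auto
  obtain R where R: "\<And>a. g a \<noteq> 0 \<Longrightarrow> norm a \<le> R"
    using bg by (auto simp: bounded_iff)
  obtain N where N: "N \<ge> 0" "\<And>x. norm (A x) \<le> norm x * N"
    using bounded_linear.nonneg_bounded[OF A] by blast
  have bound: "norm a \<le> (R + norm e) + (R + M * norm v + (R + norm e) * N)"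
    if "g (?T a + r *\<^sub>R ?v) \<noteq> 0" "\<bar>r\<bar> \<le> M" for a r
  proof -
    obtain x y where a: "a = (x, y)" by (cases a)
    have n: "norm (x + e, y + A x + r *\<^sub>R v) \<le> R"
      using R[OF that(1)] by (simp add: a)
    have "norm (x + e) \<le> R"
      using norm_fst_le[of "x + e" "y + A x + r *\<^sub>R v"] n by simp
    then have x: "norm x \<le> R + norm e"
      using norm_triangle_ineq4[of "x + e" e] by simp
    have "norm (y + A x + r *\<^sub>R v) \<le> R"
      using norm_snd_le[of "y + A x + r *\<^sub>R v" "x + e"] n by simp
    moreover have "norm y \<le> norm (y + A x + r *\<^sub>R v) + norm (A x) + norm (r *\<^sub>R v)"
      using norm_triangle_ineq4[of "y + A x + r *\<^sub>R v" "A x + r *\<^sub>R v"]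
        norm_triangle_ineq[of "A x" "r *\<^sub>R v"] by (simp add: algebra_simps)
    moreover have "norm (A x) \<le> (R + norm e) * N"
      using N(2)[of x] mult_right_mono[OF x N(1)] by linarith
    moreover have "norm (r *\<^sub>R v) \<le> M * norm v"
      using that(2) by (simp add: mult_right_mono)
    ultimately have y: "norm y \<le> R + M * norm v + (R + norm e) * N" by linarith
    show ?thesis
      using norm_Pair_le[of x y] x y by (simp add: a)
  qed
  define f where "f a = u a * segment_mean g ?v (u a) (?T a)" for a
  define f' where "f' a = g (?T a + u a *\<^sub>R ?v) * (1 + d a) - g (?T a)" for a
  have cf: "continuous_on UNIV f"
    unfolding f_def by (intro continuous_intros continuous_segment_mean g u T)
  have c1: "continuous_on UNIV (\<lambda>a. g (?T a + u a *\<^sub>R ?v) * (1 + d a))"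
    by (intro continuous_intros continuous_on_compose2[OF g] T u d) auto
  have c2: "continuous_on UNIV (\<lambda>a. g (?T a))"
    by (intro continuous_on_compose2[OF g] T) auto
  have cf': "continuous_on UNIV f'"
    unfolding f'_def by (intro continuous_on_diff c1 c2)
  have M0: "0 \<le> M" using M[of 0] by linarith
  have "bounded {a. f a \<noteq> 0}"
  proof (rule bounded_subset[OF bounded_cball])
    show "{a. f a \<noteq> 0} \<subseteq> cball 0 ((R + norm e) + (R + M * norm v + (R + norm e) * N))"
    proof
      fix a assume "a \<in> {a. f a \<noteq> 0}"
      then have "segment_mean g ?v (u a) (?T a) \<noteq> 0" by (auto simp: f_def)
      then obtain s where s: "0 \<le> s" "s \<le> 1" "g (?T a + (s * u a) *\<^sub>R ?v) \<noteq> 0"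
        using segment_mean_eq_0 by blast
      have "\<bar>s * u a\<bar> \<le> M"
        using s M[of a] mult_left_le_one_le[of "\<bar>u a\<bar>" s] by (simp add: abs_mult)
      from bound[OF s(3) this] show "a \<in> cball 0 ((R + norm e) + (R + M * norm v + (R + norm e) * N))"
        by simp
    qed
  qed
  moreover have "((\<lambda>t. f (a + t *\<^sub>R ?v)) has_real_derivative f' a) (at 0)" for a
  proof -
    obtain p where p: "\<And>t. (p has_real_derivative g (?T a + t *\<^sub>R ?v)) (at t)"
      and ps: "\<And>t s. s * segment_mean g ?v s (?T a + t *\<^sub>R ?v) = p (t + s) - p t"
      using line_antiderivative[OF g] by blast
    have Tt: "?T (a + t *\<^sub>R ?v) = ?T a + t *\<^sub>R ?v" for t
      by simp
    have "f (a + t *\<^sub>R ?v) = p (t + u (a + t *\<^sub>R ?v)) - p t" for t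
      unfolding f_def Tt by (rule ps)
    moreover have "((\<lambda>t. p (t + u (a + t *\<^sub>R ?v)) - p t) has_real_derivative f' a) (at 0)"
    proof -
      have 1: "((\<lambda>t. t + u (a + t *\<^sub>R ?v)) has_real_derivative 1 + d a) (at 0)"
        by (intro derivative_intros D)
      have "((\<lambda>t. p (t + u (a + t *\<^sub>R ?v))) has_real_derivative
          g (?T a + (0 + u (a + 0 *\<^sub>R ?v)) *\<^sub>R ?v) * (1 + d a)) (at 0)"
        by (rule DERIV_chain2[OF p 1])
      from DERIV_diff[OF this p[of 0]] show ?thesis
        by (simp add: f'_def flip: zero_prod_def)
    qed
    ultimately show ?thesis by simp
  qed
  ultimately have "integral\<^sup>L lborel f' = 0"
    using integral_directional_derivative_eq_0[OF cf cf'] by blast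
  moreover have "integral\<^sup>L lborel f' =
      (\<integral>a. g (?T a + u a *\<^sub>R ?v) * (1 + d a) \<partial>lborel) - (\<integral>a. g (?T a) \<partial>lborel)"
    unfolding f'_def
  proof (rule Bochner_Integration.integral_diff)
    let ?r = "(R + norm e) + (R + M * norm v + (R + norm e) * N)"
    show "integrable lborel (\<lambda>a. g (?T a + u a *\<^sub>R ?v) * (1 + d a))"
      by (rule integrable_continuous_bounded_support[OF c1
            bounded_subset[OF bounded_cball, of _ 0 ?r]]) (use bound[OF _ M] in auto)
    show "integrable lborel (\<lambda>a. g (?T a))"
      by (rule integrable_continuous_bounded_support[OF c2
            bounded_subset[OF bounded_cball, of _ 0 ?r]])
        (use bound[of _ 0] M0 in \<open>auto simp flip: zero_prod_def\<close>)
  qed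
  moreover have "(\<integral>a. g (?T a) \<partial>lborel) = integral\<^sup>L lborel g"
  proof -
    have "integral\<^sup>L (distr lborel lborel ?T) g = (\<integral>a. g (?T a) \<partial>lborel)"
      by (rule integral_distr)
        (use borel_measurable_continuous_onI[OF T] borel_measurable_continuous_onI[OF g] in auto)
    then show ?thesis using distr_shear[OF contA, of e] by simp
  qed
  ultimately show ?thesis by simp
qed

section \<open>The weak form of the balance law\<close>

text \<open>
  The continuity hypothesis bounds the partial derivatives one direction at a time; the
  operator norm of the derivative is controlled by the finitely many basis directions.
\<close>

lemma C1_compact_support_Lipschitz:
  fixes \<zeta> :: "'a::euclidean_space \<Rightarrow> real"
  assumes D: "\<And>a. (\<zeta> has_derivative D a) (at a)"
    and cD: "\<And>x. continuous_on UNIV (\<lambda>a. D a x)"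
    and S: "bounded {a. \<zeta> a \<noteq> 0}"
  shows "\<exists>L. \<forall>a b. \<bar>\<zeta> a - \<zeta> b\<bar> \<le> L * norm (a - b)"
    and "\<And>a x. a \<notin> closure {a. \<zeta> a \<noteq> 0} \<Longrightarrow> D a x = 0"
proof -
  show D0: "D a x = 0" if "a \<notin> closure {a. \<zeta> a \<noteq> 0}" for a x
  proof -
    have "\<forall>\<^sub>F b in nhds a. b \<in> - closure {a. \<zeta> a \<noteq> 0}"
      using that by (intro eventually_nhds_in_open) (auto intro: open_Compl)
    then have "\<forall>\<^sub>F b in nhds a. \<zeta> b = 0"
      by eventually_elim (use closure_subset[of "{a. \<zeta> a \<noteq> 0}"] in auto)
    then have "(\<zeta> has_derivative (\<lambda>_. 0)) (at a)"
      using has_derivative_transform_eventually[of "\<lambda>_. 0" "\<lambda>_. 0" a UNIV \<zeta>]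
      by (auto simp: eventually_nhds_conv_at elim: eventually_mono)
    from has_derivative_unique[OF D this] show ?thesis by simp
  qed
  have "\<forall>x. \<exists>M. \<forall>a. \<bar>D a x\<bar> \<le> M"
  proof
    fix x
    have "bounded {a. D a x \<noteq> 0}"
      by (rule bounded_subset[OF bounded_closure[OF S]]) (use D0 in blast)
    from integrable_continuous_bounded_support(2)[OF cD this]
    show "\<exists>M. \<forall>a. \<bar>D a x\<bar> \<le> M" .
  qed
  then obtain M where M: "\<And>a x. \<bar>D a x\<bar> \<le> M x" by metis
  have "onorm (D a) \<le> (\<Sum>i\<in>Basis. M i)" for a
  proof (rule onorm_le)
    fix x
    interpret D: bounded_linear "D a"
      using D has_derivative_bounded_linear by blast
    have "D a x = D a (\<Sum>i\<in>Basis. (x \<bullet> i) *\<^sub>R i)"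
      by (simp add: euclidean_representation)
    also have "\<dots> = (\<Sum>i\<in>Basis. (x \<bullet> i) * D a i)"
      by (simp add: D.sum D.scaleR)
    also have "norm \<dots> \<le> (\<Sum>i\<in>Basis. norm ((x \<bullet> i) * D a i))"
      by (rule norm_sum)
    also have "\<dots> \<le> (\<Sum>i\<in>Basis. norm x * M i)"
      by (intro sum_mono) (auto simp: abs_mult intro!: mult_mono M Basis_le_norm)
    finally show "norm (D a x) \<le> (\<Sum>i\<in>Basis. M i) * norm x"
      by (simp add: sum_distrib_left mult.commute[of _ "norm x"])
  qed
  then have "norm (\<zeta> a - \<zeta> b) \<le> (\<Sum>i\<in>Basis. M i) * norm (a - b)" for a b
    using differentiable_bound[of UNIV \<zeta> D "\<Sum>i\<in>Basis. M i" a b] D by auto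
  then show "\<exists>L. \<forall>a b. \<bar>\<zeta> a - \<zeta> b\<bar> \<le> L * norm (a - b)"
    by (intro exI[of _ "\<Sum>i\<in>Basis. M i"]) auto
qed

text \<open>
  The directions may vary with the step: the displacement of the main proof uses
  the mean \<open>u\<^sub>h\<close>, which only converges to \<open>\<phi>\<close>.
\<close>

lemma derivative_along_converging_directions:
  fixes \<zeta> :: "'a::real_normed_vector \<Rightarrow> real"
  assumes D: "(\<zeta> has_derivative D) (at a)"
    and h: "h \<longlonglongrightarrow> 0" "\<And>n. h n > 0" and x: "x \<longlonglongrightarrow> y"
  shows "(\<lambda>n. (\<zeta> (a + h n *\<^sub>R x n) - \<zeta> a) / h n) \<longlonglongrightarrow> D y"
proof -
  interpret D: bounded_linear D
    using D by (rule has_derivative_bounded_linear)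
  obtain e where e: "\<And>k. \<zeta> (a + k) = \<zeta> a + D k + e k" "e 0 = 0"
    and e0: "((\<lambda>k. norm (e k) / norm k) \<longlongrightarrow> 0) (at 0)"
  proof -
    define e where "e k = \<zeta> (a + k) - \<zeta> a - D k" for k
    have "((\<lambda>k. norm (e k) / norm k) \<longlongrightarrow> 0) (at 0)"
      using D by (simp add: has_derivative_at e_def)
    then show ?thesis
      by (intro that[of e]) (auto simp: e_def D.zero)
  qed
  have c: "isCont (\<lambda>k. e k / norm k) 0"
    using tendsto_rabs_zero_cancel[of "\<lambda>k. e k / norm k" "at 0"] e0 e(2) by (simp add: isCont_def)
  have hx: "(\<lambda>n. h n *\<^sub>R x n) \<longlonglongrightarrow> 0"
    using tendsto_scaleR[OF h(1) x] by simp
  have "(\<lambda>n. D (x n) + e (h n *\<^sub>R x n) / norm (h n *\<^sub>R x n) * norm (x n)) \<longlonglongrightarrow> D y + e 0 / norm (0::'a) * norm y"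
    by (intro tendsto_intros D.tendsto x isCont_tendsto_compose[OF c hx])
  moreover have "(\<zeta> (a + h n *\<^sub>R x n) - \<zeta> a) / h n = D (x n) + e (h n *\<^sub>R x n) / norm (h n *\<^sub>R x n) * norm (x n)" for n
  proof -
    have "e (h n *\<^sub>R x n) / norm (h n *\<^sub>R x n) * norm (x n) = e (h n *\<^sub>R x n) / h n"
      using h(2)[of n] e(2) by (cases "x n = 0") simp_all
    then show ?thesis
      using h(2)[of n] by (simp add: e(1) D.scaleR add_divide_distrib)
  qed
  ultimately show ?thesis by simp
qed

text \<open>
  The analytic core, free of any group structure: for \<open>X = (e, A x)\<close> it derives
  \<open>X \<phi> + \<partial>\<^sub>v (\<phi>\<^sup>2 / 2) = w\<close> in the weak sense from a parabolic Lipschitz estimate near the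
  support of the test function and a parabolic first-order expansion almost everywhere. The
  expansion enters twice: with \<open>h > 0\<close> it identifies the limit \<open>w\<close>, and with \<open>h = 0\<close> it says
  that \<open>\<phi>\<close> has vertical increments \<open>o(|\<tau>|\<^sup>1\<^sup>/\<^sup>2)\<close>. Without this little-o
  the commutators \<open>(\<phi> - u\<^sub>h) d\<^sub>h\<close> and \<open>h u\<^sub>h d\<^sub>h\<close> would be bounded but need not vanish.
\<close>

lemma burgers_weak_form:
  fixes \<phi> \<zeta> w :: "'a::euclidean_space \<times> 'b::euclidean_space \<Rightarrow> real"
    and e :: 'a and v :: 'b and A :: "'a \<Rightarrow> 'b"
  assumes A: "bounded_linear A"
    and \<phi>: "continuous_on UNIV \<phi>" and M: "\<And>a. \<bar>\<phi> a\<bar> \<le> M"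
    and K: "compact K" and d: "d > 0" "\<And>a b. \<zeta> b \<noteq> 0 \<Longrightarrow> norm (b - a) \<le> d \<Longrightarrow> a \<in> K"
    and D: "\<And>a. (\<zeta> has_derivative D a) (at a)"
    and cD: "\<And>x. continuous_on UNIV (\<lambda>a. D a x)"
    and w: "w \<in> borel_measurable lebesgue"
    and \<rho>: "\<rho> > 0" and C: "C \<ge> 0"
    and lip: "\<And>a h \<tau>. a \<in> K \<Longrightarrow> 0 \<le> h \<Longrightarrow> h \<le> \<rho> \<Longrightarrow> \<bar>\<tau>\<bar> \<le> \<rho> \<Longrightarrow>
      \<bar>\<phi> (a + h *\<^sub>R (e, A (fst a)) + (h * \<phi> a + \<tau>) *\<^sub>R (0, v)) - \<phi> a\<bar> \<le> C * (h + sqrt \<bar>\<tau>\<bar>)"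
    and diff: "AE a in lebesgue. a \<in> K \<longrightarrow> (\<forall>\<eta>>0. \<exists>\<delta>>0. \<forall>h \<tau>. 0 \<le> h \<and> h < \<delta> \<and> \<bar>\<tau>\<bar> < \<delta> \<longrightarrow>
      \<bar>\<phi> (a + h *\<^sub>R (e, A (fst a)) + (h * \<phi> a + \<tau>) *\<^sub>R (0, v)) - \<phi> a - w a * h\<bar> \<le> \<eta> * (h + sqrt \<bar>\<tau>\<bar>))"
  shows "(\<integral>a. \<phi> a * (D a (e, A (fst a)) + \<phi> a / 2 * D a (0, v)) \<partial>lebesgue) =
    - (\<integral>a. w a * \<zeta> a \<partial>lebesgue)"
proof -
  let ?v = "(0, v) :: 'a \<times> 'b"
  define X where "X a = (e, A (fst a))" for a :: "'a \<times> 'b"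
  note lip = lip[folded X_def] and diff = diff[folded X_def]
  have cA: "continuous_on UNIV A"
    using A by (rule linear_continuous_on)
  have cX: "continuous_on UNIV X"
    unfolding X_def by (intro continuous_intros continuous_on_compose2[OF cA]) auto
  have c\<zeta>: "continuous_on UNIV \<zeta>"
    by (rule continuous_at_imp_continuous_on) (intro ballI has_derivative_continuous[OF D])
  have \<zeta>K: "{a. \<zeta> a \<noteq> 0} \<subseteq> K"
    using d by force
  have bK: "bounded K" using K by (rule compact_imp_bounded)
  have b\<zeta>: "bounded {a. \<zeta> a \<noteq> 0}"
    by (rule bounded_subset[OF bK \<zeta>K])
  have DK: "D a x = 0" if "a \<notin> K" for a x
    using C1_compact_support_Lipschitz(2)[OF D cD b\<zeta>] that closure_minimal[OF \<zeta>K compact_imp_closed[OF K]]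
    by blast
  obtain L0 where L0: "\<And>a b. \<bar>\<zeta> a - \<zeta> b\<bar> \<le> L0 * norm (a - b)"
    using C1_compact_support_Lipschitz(1)[OF D cD b\<zeta>] by blast
  define L where "L = max L0 0"
  have L: "0 \<le> L" "\<And>a b. \<bar>\<zeta> a - \<zeta> b\<bar> \<le> L * norm (a - b)"
    using order_trans[OF L0 mult_right_mono[of L0 L]] by (auto simp: L_def)
  obtain Z where Z: "\<And>a. \<bar>\<zeta> a\<bar> \<le> Z"
    using integrable_continuous_bounded_support(2)[OF c\<zeta> b\<zeta>] by blast
  obtain V where V: "\<And>a. \<bar>D a ?v\<bar> \<le> V"
    using integrable_continuous_bounded_support(2)[OF cD[of ?v] bounded_subset[OF bK]] DK by blast
  have M0: "0 \<le> M" and Z0: "0 \<le> Z"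
    using M[of 0] Z[of 0] by linarith+
  obtain N where N: "N \<ge> 0" "\<And>x. norm (A x) \<le> norm x * N"
    using bounded_linear.nonneg_bounded[OF A] by blast
  obtain R where R: "\<And>a. a \<in> K \<Longrightarrow> norm a \<le> R"
    using bK by (auto simp: bounded_iff)
  define Q where "Q = norm e + (R + norm e) * N + M * norm v"

  define u where "u h a = segment_mean \<phi> ?v (h\<^sup>2) a" for h a
  define dv where "dv h a = (\<phi> (a + h\<^sup>2 *\<^sub>R ?v) - \<phi> a) / h\<^sup>2" for h a
  define F where "F h a = a + h *\<^sub>R (X a + u h a *\<^sub>R ?v)" for h a
  have cu: "continuous_on UNIV (u h)" for h
    unfolding u_def by (intro continuous_segment_mean \<phi> continuous_intros)
  have cdv: "continuous_on UNIV (dv h)" for h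
    unfolding dv_def divide_inverse
    by (intro continuous_intros continuous_on_compose2[OF \<phi>]) (auto intro!: continuous_intros)
  have cF: "continuous_on UNIV (F h)" for h
    unfolding F_def by (intro continuous_intros cX cu)
  have uM: "\<bar>u h a\<bar> \<le> M" for h a
    using segment_mean_close[OF \<phi>, of a "h\<^sup>2" ?v 0 M] M by (simp add: u_def)
  have du: "((\<lambda>t. u h (a + t *\<^sub>R ?v)) has_real_derivative dv h a) (at 0)" if "h > 0" for h a
    unfolding u_def dv_def using that by (intro segment_mean_derivative \<phi>) auto

  have displacement: "norm (X a + r *\<^sub>R ?v) \<le> Q" if "norm (fst a) \<le> R + norm e" "\<bar>r\<bar> \<le> M" for a r
  proof -
    have "norm (X a + r *\<^sub>R ?v) \<le> norm e + norm (A (fst a) + r *\<^sub>R v)"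
      unfolding X_def using norm_Pair_le[of e "A (fst a) + r *\<^sub>R v"] by simp
    also have "norm (A (fst a) + r *\<^sub>R v) \<le> norm (A (fst a)) + norm (r *\<^sub>R v)"
      by (rule norm_triangle_ineq)
    also have "norm (A (fst a)) \<le> (R + norm e) * N"
      using N(2)[of "fst a"] mult_right_mono[OF that(1) N(1)] by linarith
    also have "norm (r *\<^sub>R v) \<le> M * norm v"
      using that(2) by (simp add: mult_right_mono)
    finally show ?thesis by (simp add: Q_def)
  qed

  \<comment> \<open>The displacement grows with the first layer of \<open>a\<close>, so its size is read off the endpoint,
    which lies in the support of \<open>\<zeta>\<close>.\<close>
  have FK: "a \<in> K" if "\<zeta> (F h a) \<noteq> 0" "0 \<le> h" "h \<le> 1" "h * Q \<le> d" for h a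
  proof -
    have "norm (F h a) \<le> R"
      using that(1) \<zeta>K R by blast
    then have "norm (fst (F h a)) \<le> R"
      using norm_fst_le[of "fst (F h a)" "snd (F h a)"] by simp
    then have "norm (fst a + h *\<^sub>R e) \<le> R"
      by (simp add: F_def X_def)
    then have "norm (fst a) \<le> R + norm (h *\<^sub>R e)"
      using norm_triangle_ineq4[of "fst a + h *\<^sub>R e" "h *\<^sub>R e"] by simp
    also have "norm (h *\<^sub>R e) \<le> norm e"
      using that by (simp add: mult_left_le_one_le)
    finally have "norm (X a + u h a *\<^sub>R ?v) \<le> Q"
      by (intro displacement uM) simp
    then have "norm (F h a - a) \<le> d"
      using that mult_left_mono[of _ Q h] unfolding F_def by fastforce
    with d(2) that(1) show ?thesis by blast
  qed

  \<comment> \<open>\<open>H\<close> is written so that each summand visibly converges; regrouped as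
    \<open>(G1 - G2) / h - G3\<close> below, it has integral 0.\<close>
  define H where "H h a = ((\<phi> (F h a) - \<phi> a) / h) * \<zeta> (F h a) * (1 + h * dv h a)
      + \<phi> a * ((\<zeta> (F h a) - \<zeta> a) / h) + (\<phi> a - u h a) * \<zeta> (F h a) * dv h a
      + u h a * dv h a * (\<zeta> (F h a) - \<zeta> a) - (u h a)\<^sup>2 / 2 * D a ?v" for h a

  have H0: "integral\<^sup>L lborel (H h) = 0" if h: "0 < h" "h \<le> 1" "h * Q \<le> d" for h
  proof -
    define G1 where "G1 a = \<phi> (F h a) * \<zeta> (F h a) * (1 + h * dv h a)" for a
    define G2 where "G2 a = \<phi> a * \<zeta> a" for a
    define G3 where "G3 a = u h a * dv h a * \<zeta> a + (u h a)\<^sup>2 / 2 * D a ?v" for a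
    have Heq: "H h a = (G1 a - G2 a) / h - G3 a" for a
      using h by (simp add: H_def G1_def G2_def G3_def field_simps power2_eq_square)
    have c: "continuous_on UNIV G1" "continuous_on UNIV G2" "continuous_on UNIV G3"
      unfolding G1_def G2_def G3_def
      by (intro continuous_intros cu cdv \<phi> c\<zeta> cD continuous_on_compose2[OF \<phi> cF]
          continuous_on_compose2[OF c\<zeta> cF]; simp)+
    have "{a. G1 a \<noteq> 0} \<subseteq> K" "{a. G2 a \<noteq> 0} \<subseteq> K" "{a. G3 a \<noteq> 0} \<subseteq> K"
      using FK[of h] h \<zeta>K DK by (force simp: G1_def G2_def G3_def)+
    then have b: "bounded {a. G1 a \<noteq> 0}" "bounded {a. G2 a \<noteq> 0}" "bounded {a. G3 a \<noteq> 0}"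
      using bounded_subset[OF bK] by auto
    note i = integrable_continuous_bounded_support(1)[OF c(1) b(1)]
      integrable_continuous_bounded_support(1)[OF c(2) b(2)]
      integrable_continuous_bounded_support(1)[OF c(3) b(3)]
    have "integral\<^sup>L lborel G1 = integral\<^sup>L lborel G2"
    proof -
      have hA: "bounded_linear (\<lambda>x. h *\<^sub>R A x)"
        by (rule bounded_linear_compose[OF bounded_linear_scaleR_right A])
      have "((\<lambda>t. h * u h (a + t *\<^sub>R ?v)) has_real_derivative h * dv h a) (at 0)" for a
        by (intro DERIV_cmult du h)
      moreover have "\<bar>h * u h a\<bar> \<le> M" for a
        using h uM[of h a] mult_left_le_one_le[of "\<bar>u h a\<bar>" h] by (simp add: abs_mult)
      ultimately have "(\<integral>a. G2 ((fst a + h *\<^sub>R e, snd a + h *\<^sub>R A (fst a)) + (h * u h a) *\<^sub>R ?v) *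
          (1 + h * dv h a) \<partial>lborel) = integral\<^sup>L lborel G2"
        by (intro integral_shear_displacement[OF c(2) b(2) _ _ _ _ hA])
          (auto intro!: continuous_intros cu cdv)
      moreover have "(fst a + h *\<^sub>R e, snd a + h *\<^sub>R A (fst a)) + (h * u h a) *\<^sub>R ?v = F h a" for a
        by (simp add: F_def X_def prod_eq_iff scaleR_add_right)
      ultimately show ?thesis
        by (simp add: G1_def[abs_def] G2_def)
    qed
    moreover have "integral\<^sup>L lborel G3 = 0"
    proof (rule integral_directional_derivative_eq_0)
      show "continuous_on UNIV (\<lambda>a. (u h a)\<^sup>2 / 2 * \<zeta> a)"
        by (intro continuous_intros cu c\<zeta>) simp
      show "bounded {a. (u h a)\<^sup>2 / 2 * \<zeta> a \<noteq> 0}"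
        by (rule bounded_subset[OF b\<zeta>]) auto
      fix a
      have "((\<lambda>t. a + t *\<^sub>R ?v) has_derivative (\<lambda>t. t *\<^sub>R ?v)) (at 0)"
        by (auto intro!: derivative_eq_intros)
      from has_derivative_compose[OF this, of \<zeta> "D a"] D[of a]
      have "((\<lambda>t. \<zeta> (a + t *\<^sub>R ?v)) has_derivative (\<lambda>t. D a (t *\<^sub>R ?v))) (at 0)"
        by (simp flip: zero_prod_def)
      moreover have "(\<lambda>t. D a (t *\<^sub>R ?v)) = (*) (D a ?v)"
        using linear_scale[OF has_derivative_linear[OF D[of a]], of _ ?v] by (auto simp: fun_eq_iff mult.commute)
      ultimately have \<zeta>': "((\<lambda>t. \<zeta> (a + t *\<^sub>R ?v)) has_real_derivative D a ?v) (at 0)"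
        by (simp add: has_field_derivative_def)
      show "((\<lambda>t. (u h (a + t *\<^sub>R ?v))\<^sup>2 / 2 * \<zeta> (a + t *\<^sub>R ?v)) has_real_derivative G3 a) (at 0)"
        unfolding G3_def
        by (rule DERIV_cong[OF DERIV_mult[OF DERIV_cdivide[OF DERIV_power[OF du[OF h(1)]]] \<zeta>']])
          (simp flip: zero_prod_def)
    qed (rule c(3))
    ultimately show ?thesis
      unfolding Heq[abs_def] using i by simp
  qed

  \<comment> \<open>Steps below \<open>h0\<close> keep all displacements within the range of the hypotheses.\<close>
  obtain h0 where h0: "0 < h0" "h0 \<le> 1" "h0 \<le> \<rho>" "h0 * Q \<le> d" "h0 * C * h0 \<le> \<rho>"
  proof -
    have "((\<lambda>t. t) \<longlongrightarrow> 0) (at_right (0::real))" "((\<lambda>t. t * Q) \<longlongrightarrow> 0) (at_right (0::real))"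
      "((\<lambda>t. t * C * t) \<longlongrightarrow> 0) (at_right (0::real))"
      by (auto intro!: tendsto_eq_intros)
    note lims = this
    have "\<forall>\<^sub>F t in at_right 0. t < min 1 \<rho>"
      by (rule order_tendstoD(2)[OF lims(1)]) (use \<rho> in simp)
    moreover have "\<forall>\<^sub>F t in at_right 0. t * Q < d"
      by (rule order_tendstoD(2)[OF lims(2)]) (use d(1) in simp)
    moreover have "\<forall>\<^sub>F t in at_right 0. t * C * t < \<rho>"
      by (rule order_tendstoD(2)[OF lims(3)]) (use \<rho> in simp)
    moreover note eventually_at_right_less[of "0::real"]
    ultimately have "\<forall>\<^sub>F t in at_right 0. 0 < t \<and> t \<le> 1 \<and> t \<le> \<rho> \<and> t * Q \<le> d \<and> t * C * t \<le> \<rho>"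
      by eventually_elim auto
    then show ?thesis
      using that eventually_happens[of _ "at_right (0::real)"] trivial_limit_at_right_real by blast
  qed
  define hs where "hs n = h0 / real (Suc n)" for n
  have hs: "0 < hs n" "hs n \<le> h0" for n
    using h0 by (auto simp: hs_def divide_simps)
  \<comment> \<open>For empty \<open>K\<close> the bound \<open>R\<close> is arbitrary and \<open>Q\<close> may be negative.\<close>
  have Q0: "0 \<le> Q" if ne: "K \<noteq> {}"
  proof -
    obtain a where "a \<in> K" using ne by blast
    then have "0 \<le> R" using R[of a] norm_ge_zero[of a] by linarith
    then show ?thesis using N M0 by (simp add: Q_def)
  qed
  have hs_small: "hs n \<le> 1" "hs n \<le> \<rho>" "hs n * Q \<le> d" "hs n * C * hs n \<le> \<rho>" for n
  proof -
    show "hs n \<le> 1" "hs n \<le> \<rho>" using hs[of n] h0 by linarith+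
    show "hs n * Q \<le> d"
    proof (cases "0 \<le> Q")
      case True
      then show ?thesis using mult_right_mono[OF hs(2)[of n] True] h0 by linarith
    next
      case False
      then show ?thesis using hs(1)[of n] d(1) mult_pos_neg[of "hs n" Q] by linarith
    qed
    have "hs n * C * hs n \<le> h0 * C * h0"
      using hs[of n] C by (intro mult_mono) auto
    then show "hs n * C * hs n \<le> \<rho>" using h0 by linarith
  qed
  have hs0: "hs \<longlonglongrightarrow> 0"
    unfolding hs_def using tendsto_mult[OF tendsto_const[of h0] LIMSEQ_inverse_real_of_nat]
    by (simp add: divide_inverse)

  \<comment> \<open>\<open>F\<close> differs from the exact displacement by the vertical step \<open>\<tau> = h (u - \<phi>)\<close>, and
    \<open>|\<tau>| \<le> C h\<^sup>2\<close> has the homogeneous size of \<open>h\<close>.\<close>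
  have F_eq: "F h a = a + h *\<^sub>R X a + (h * \<phi> a + h * (u h a - \<phi> a)) *\<^sub>R ?v" for h a
    by (simp add: F_def algebra_simps)
  have vert: "\<bar>\<phi> (a + s *\<^sub>R ?v) - \<phi> a\<bar> \<le> C * sqrt s" if "a \<in> K" "0 \<le> s" "s \<le> \<rho>" for a s
    using lip[of a 0 s] that \<rho> by simp
  have u_close: "\<bar>u h a - \<phi> a\<bar> \<le> C * h" if "a \<in> K" "0 < h" "h \<le> 1" "h \<le> \<rho>" for a h
    unfolding u_def
  proof (rule segment_mean_close[OF \<phi>])
    fix \<sigma> :: real assume \<sigma>: "0 \<le> \<sigma>" "\<sigma> \<le> 1"
    have le: "\<sigma> * h\<^sup>2 \<le> h\<^sup>2" using \<sigma> by (simp add: mult_left_le_one_le)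
    moreover have "h\<^sup>2 \<le> h" using that by (simp add: power2_eq_square mult_left_le_one_le)
    ultimately have "\<sigma> * h\<^sup>2 \<le> \<rho>" using that by linarith
    moreover have "sqrt (\<sigma> * h\<^sup>2) \<le> sqrt (h\<^sup>2)"
      by (rule real_sqrt_le_mono[OF le])
    moreover have "\<bar>\<phi> (a + (\<sigma> * h\<^sup>2) *\<^sub>R ?v) - \<phi> a\<bar> \<le> C * sqrt (\<sigma> * h\<^sup>2)"
      using \<sigma> \<open>\<sigma> * h\<^sup>2 \<le> \<rho>\<close> that by (intro vert) auto
    ultimately show "\<bar>\<phi> (a + (\<sigma> * h\<^sup>2) *\<^sub>R ?v) - \<phi> a\<bar> \<le> C * h"
      using mult_left_mono[of "sqrt (\<sigma> * h\<^sup>2)" h C] C that by simp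
  qed
  have dv_bound: "\<bar>h * dv h a\<bar> \<le> C" if "a \<in> K" "0 < h" "h \<le> 1" "h \<le> \<rho>" for a h
  proof -
    have "h\<^sup>2 \<le> h" using that by (simp add: power2_eq_square mult_left_le_one_le)
    then have "\<bar>\<phi> (a + h\<^sup>2 *\<^sub>R ?v) - \<phi> a\<bar> \<le> C * h"
      using vert[of a "h\<^sup>2"] that by simp
    then show ?thesis
      using that by (simp add: dv_def power2_eq_square abs_mult divide_simps)
  qed
  define E where "E = C * (1 + sqrt C) * Z * (1 + C) + M * (L * Q) + C * Z * C + M * C * (L * Q) + M\<^sup>2 / 2 * V"
  have H_bound: "\<bar>H (hs n) a\<bar> \<le> E" if a: "a \<in> K" for n a
  proof -
    define h where "h = hs n"
    have h: "0 < h" "h \<le> 1" "h \<le> \<rho>" "h * C * h \<le> \<rho>"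
      using hs(1) hs_small by (auto simp: h_def)
    define \<tau> where "\<tau> = h * (u h a - \<phi> a)"
    have \<tau>h: "\<bar>\<tau>\<bar> \<le> h * (C * h)"
      unfolding \<tau>_def using u_close[OF a h(1-3)] h by (simp add: abs_mult)
    have \<tau>\<rho>: "\<bar>\<tau>\<bar> \<le> \<rho>" using \<tau>h h(4) by (simp add: mult.assoc)
    have "sqrt \<bar>\<tau>\<bar> \<le> sqrt (C * h\<^sup>2)"
      using \<tau>h by (simp add: power2_eq_square mult_ac)
    also have "\<dots> = sqrt C * h" using h by (simp add: real_sqrt_mult)
    finally have sq: "sqrt \<bar>\<tau>\<bar> \<le> sqrt C * h" .
    have "\<bar>\<phi> (F h a) - \<phi> a\<bar> \<le> C * (h + sqrt \<bar>\<tau>\<bar>)"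
      using lip[OF a _ h(3) \<tau>\<rho>] h F_eq[of h a] by (simp add: \<tau>_def)
    also have "\<dots> \<le> C * (h + sqrt C * h)"
      using sq C by (intro mult_left_mono) auto
    finally have "\<bar>\<phi> (F h a) - \<phi> a\<bar> \<le> C * (1 + sqrt C) * h"
      by (simp add: algebra_simps)
    then have 1: "\<bar>(\<phi> (F h a) - \<phi> a) / h\<bar> \<le> C * (1 + sqrt C)"
      using h by (simp add: divide_simps)
    have 2: "\<bar>1 + h * dv h a\<bar> \<le> 1 + C"
      using dv_bound[OF a h(1-3)] by linarith
    have "norm (fst a) \<le> R"
      using R[OF a] norm_fst_le[of "fst a" "snd a"] by simp
    then have "norm (X a + u h a *\<^sub>R ?v) \<le> Q"
      by (intro displacement uM) (simp add: add_increasing2)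
    then have "norm (F h a - a) \<le> h * Q"
      using h by (simp add: F_def)
    then have 3: "\<bar>\<zeta> (F h a) - \<zeta> a\<bar> \<le> L * (h * Q)"
      using L(2)[of "F h a" a] mult_left_mono[OF _ L(1)] by fastforce
    then have 4: "\<bar>(\<zeta> (F h a) - \<zeta> a) / h\<bar> \<le> L * Q"
      using h by (simp add: divide_simps mult_ac)
    have Q: "0 \<le> Q" using Q0 a by blast
    have t1: "\<bar>((\<phi> (F h a) - \<phi> a) / h) * \<zeta> (F h a) * (1 + h * dv h a)\<bar> \<le> C * (1 + sqrt C) * Z * (1 + C)"
      unfolding abs_mult[of "_ * _"] abs_mult[of "_ / _" "\<zeta> _"] using 1 2 Z[of "F h a"] C Z0 by (intro mult_mono) auto
    have t2: "\<bar>\<phi> a * ((\<zeta> (F h a) - \<zeta> a) / h)\<bar> \<le> M * (L * Q)"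
      unfolding abs_mult using 4 M[of a] M0 by (intro mult_mono) auto
    have "(\<phi> a - u h a) * \<zeta> (F h a) * dv h a = ((\<phi> a - u h a) / h) * \<zeta> (F h a) * (h * dv h a)"
      using h by simp
    also have "\<bar>\<dots>\<bar> \<le> C * Z * C"
    proof -
      have "\<bar>(\<phi> a - u h a) / h\<bar> \<le> C"
        using u_close[OF a h(1-3)] h by (simp add: divide_simps abs_minus_commute)
      then show ?thesis
        unfolding abs_mult[of "_ * _" "h * _"] abs_mult[of "_ / _" "\<zeta> _"] using dv_bound[OF a h(1-3)] Z[of "F h a"] C Z0
        by (intro mult_mono) auto
    qed
    finally have t3: "\<bar>(\<phi> a - u h a) * \<zeta> (F h a) * dv h a\<bar> \<le> C * Z * C" .
    have "u h a * dv h a * (\<zeta> (F h a) - \<zeta> a) = u h a * (h * dv h a) * ((\<zeta> (F h a) - \<zeta> a) / h)"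
      using h by simp
    also have "\<bar>\<dots>\<bar> \<le> M * C * (L * Q)"
      unfolding abs_mult[of "_ * _" "_ / _"] abs_mult[of "u h a"] using dv_bound[OF a h(1-3)] uM[of h a] 4 C M0
      by (intro mult_mono) auto
    finally have t4: "\<bar>u h a * dv h a * (\<zeta> (F h a) - \<zeta> a)\<bar> \<le> M * C * (L * Q)" .
    have "(u h a)\<^sup>2 \<le> M\<^sup>2"
      using uM[of h a] M0 by (simp add: abs_le_square_iff[symmetric])
    then have t5: "\<bar>(u h a)\<^sup>2 / 2 * D a ?v\<bar> \<le> M\<^sup>2 / 2 * V"
      unfolding abs_mult using V[of a] by (intro mult_mono) auto
    show ?thesis
      unfolding h_def[symmetric] H_def E_def using t1 t2 t3 t4 t5 by linarith
  qed
  have H_outside: "H (hs n) a = 0" if "a \<notin> K" for n a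
  proof -
    have "\<zeta> (F (hs n) a) = 0"
      using FK[of "hs n" a] hs(1)[of n] hs_small[of n] that by force
    moreover have "\<zeta> a = 0" using \<zeta>K that by blast
    ultimately show ?thesis by (simp add: H_def DK[OF that])
  qed

  define J where "J a = \<phi> a * (D a (X a) + \<phi> a / 2 * D a ?v)" for a
  define Hlim where "Hlim a = w a * \<zeta> a + J a" for a
  have conv: "(\<lambda>n. H (hs n) a) \<longlonglongrightarrow> Hlim a"
    if a: "a \<in> K" and df: "\<forall>\<eta>>0. \<exists>\<delta>>0. \<forall>h \<tau>. 0 \<le> h \<and> h < \<delta> \<and> \<bar>\<tau>\<bar> < \<delta> \<longrightarrow>
      \<bar>\<phi> (a + h *\<^sub>R X a + (h * \<phi> a + \<tau>) *\<^sub>R ?v) - \<phi> a - w a * h\<bar> \<le> \<eta> * (h + sqrt \<bar>\<tau>\<bar>)" for a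
  proof -
    have small: "\<forall>\<^sub>F n in sequentially. hs n < \<delta>" if "\<delta> > 0" for \<delta>
      using order_tendstoD(2)[OF hs0 that] .
    \<comment> \<open>The expansion with \<open>h = 0\<close>, on the whole segment over which \<open>u\<close> averages.\<close>
    have vert_o: "\<forall>\<^sub>F n in sequentially. \<forall>\<sigma>. 0 \<le> \<sigma> \<and> \<sigma> \<le> 1 \<longrightarrow>
        \<bar>\<phi> (a + (\<sigma> * (hs n)\<^sup>2) *\<^sub>R ?v) - \<phi> a\<bar> \<le> \<eta> * hs n" if \<eta>: "\<eta> > 0" for \<eta>
    proof -
      from df \<eta> obtain \<delta> where \<delta>: "\<delta> > 0" "\<And>\<tau>. \<bar>\<tau>\<bar> < \<delta> \<Longrightarrow> \<bar>\<phi> (a + \<tau> *\<^sub>R ?v) - \<phi> a\<bar> \<le> \<eta> * sqrt \<bar>\<tau>\<bar>"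
        by (metis (no_types, lifting) add.right_neutral add_0 diff_zero mult_zero_left mult_zero_right order_refl
            scaleR_zero_left)
      from small[OF \<delta>(1)] show ?thesis
      proof eventually_elim
        case (elim n)
        have "(hs n)\<^sup>2 \<le> hs n"
          using hs(1)[of n] hs_small(1)[of n] by (simp add: power2_eq_square mult_left_le_one_le)
        show ?case
        proof safe
          fix \<sigma> :: real assume \<sigma>: "0 \<le> \<sigma>" "\<sigma> \<le> 1"
          have le: "\<sigma> * (hs n)\<^sup>2 \<le> (hs n)\<^sup>2" using \<sigma> by (simp add: mult_left_le_one_le)
          then have "\<bar>\<phi> (a + (\<sigma> * (hs n)\<^sup>2) *\<^sub>R ?v) - \<phi> a\<bar> \<le> \<eta> * sqrt (\<sigma> * (hs n)\<^sup>2)"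
            using \<delta>(2)[of "\<sigma> * (hs n)\<^sup>2"] \<sigma> \<open>(hs n)\<^sup>2 \<le> hs n\<close> elim by simp
          also have "sqrt (\<sigma> * (hs n)\<^sup>2) \<le> sqrt ((hs n)\<^sup>2)"
            using le by (rule real_sqrt_le_mono)
          finally show "\<bar>\<phi> (a + (\<sigma> * (hs n)\<^sup>2) *\<^sub>R ?v) - \<phi> a\<bar> \<le> \<eta> * hs n"
            using hs(1)[of n] \<eta> by (simp add: mult_left_mono)
        qed
      qed
    qed
    have u_o: "(\<lambda>n. (\<phi> a - u (hs n) a) / hs n) \<longlonglongrightarrow> 0"
    proof (rule LIMSEQ_I)
      fix r :: real assume r: "r > 0"
      have "\<forall>\<^sub>F n in sequentially. norm ((\<phi> a - u (hs n) a) / hs n - 0) < r"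
        using vert_o[OF half_gt_zero[OF r]]
      proof eventually_elim
        case (elim n)
        then have "\<bar>u (hs n) a - \<phi> a\<bar> \<le> r / 2 * hs n"
          unfolding u_def by (intro segment_mean_close \<phi>) auto
        also have "\<dots> < r * hs n" using r hs(1)[of n] by simp
        finally show ?case using hs(1)[of n] by (simp add: divide_simps abs_minus_commute)
      qed
      then show "\<exists>no. \<forall>n\<ge>no. norm ((\<phi> a - u (hs n) a) / hs n - 0) < r"
        by (simp add: eventually_sequentially)
    qed
    have dv_o: "(\<lambda>n. hs n * dv (hs n) a) \<longlonglongrightarrow> 0"
    proof (rule LIMSEQ_I)
      fix r :: real assume r: "r > 0"
      have "\<forall>\<^sub>F n in sequentially. norm (hs n * dv (hs n) a - 0) < r"
        using vert_o[OF half_gt_zero[OF r]]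
      proof eventually_elim
        case (elim n)
        then have "\<bar>\<phi> (a + (hs n)\<^sup>2 *\<^sub>R ?v) - \<phi> a\<bar> \<le> r / 2 * hs n"
          by (auto dest: spec[of _ 1])
        also have "\<dots> < r * hs n" using r hs(1)[of n] by simp
        finally show ?case using hs(1)[of n]
          by (simp add: dv_def power2_eq_square abs_mult divide_simps)
      qed
      then show "\<exists>no. \<forall>n\<ge>no. norm (hs n * dv (hs n) a - 0) < r"
        by (simp add: eventually_sequentially)
    qed
    have u_lim: "(\<lambda>n. u (hs n) a) \<longlonglongrightarrow> \<phi> a"
    proof -
      have "(\<lambda>n. \<phi> a - (\<phi> a - u (hs n) a) / hs n * hs n) \<longlonglongrightarrow> \<phi> a - 0 * 0"
        by (intro tendsto_intros u_o hs0)
      moreover have "\<phi> a - (\<phi> a - u (hs n) a) / hs n * hs n = u (hs n) a" for n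
        using hs(1)[of n] by simp
      ultimately show ?thesis by simp
    qed
    have \<zeta>_quot: "(\<lambda>n. (\<zeta> (F (hs n) a) - \<zeta> a) / hs n) \<longlonglongrightarrow> D a (X a + \<phi> a *\<^sub>R ?v)"
      unfolding F_def
      by (rule derivative_along_converging_directions[OF D hs0 hs(1)]) (intro tendsto_intros u_lim)
    have \<zeta>_lim: "(\<lambda>n. \<zeta> (F (hs n) a)) \<longlonglongrightarrow> \<zeta> a"
    proof -
      have "(\<lambda>n. \<zeta> a + (\<zeta> (F (hs n) a) - \<zeta> a) / hs n * hs n) \<longlonglongrightarrow> \<zeta> a + D a (X a + \<phi> a *\<^sub>R ?v) * 0"
        by (intro tendsto_intros \<zeta>_quot hs0)
      moreover have "\<zeta> a + (\<zeta> (F (hs n) a) - \<zeta> a) / hs n * hs n = \<zeta> (F (hs n) a)" for n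
        using hs(1)[of n] by simp
      ultimately show ?thesis by simp
    qed
    have \<phi>_quot: "(\<lambda>n. (\<phi> (F (hs n) a) - \<phi> a) / hs n) \<longlonglongrightarrow> w a"
    proof (rule LIMSEQ_I)
      fix r :: real assume r: "r > 0"
      \<comment> \<open>\<open>1 + sqrt C\<close> bounds \<open>(h + sqrt |\<tau>|) / h\<close>; the 2 makes the final inequality strict.\<close>
      define \<eta> where "\<eta> = r / (2 + sqrt C)"
      have \<eta>: "\<eta> > 0" using r C by (simp add: \<eta>_def add_pos_nonneg)
      from df[rule_format, OF \<eta>] obtain \<delta> where \<delta>0: "\<delta> > 0 \<and> (\<forall>h \<tau>. 0 \<le> h \<and> h < \<delta> \<and> \<bar>\<tau>\<bar> < \<delta> \<longrightarrow>
        \<bar>\<phi> (a + h *\<^sub>R X a + (h * \<phi> a + \<tau>) *\<^sub>R ?v) - \<phi> a - w a * h\<bar> \<le> \<eta> * (h + sqrt \<bar>\<tau>\<bar>))" ..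
      note \<delta> = \<delta>0[THEN conjunct1] \<delta>0[THEN conjunct2, rule_format, OF conjI[OF _ conjI]]
      have "(\<lambda>n. hs n * (C * hs n)) \<longlonglongrightarrow> 0 * (C * 0)"
        by (intro tendsto_intros hs0)
      then have "\<forall>\<^sub>F n in sequentially. hs n * (C * hs n) < \<delta>"
        using \<delta>(1) by (auto dest!: order_tendstoD(2)[of _ 0])
      with small[OF \<delta>(1)] have "\<forall>\<^sub>F n in sequentially. norm ((\<phi> (F (hs n) a) - \<phi> a) / hs n - w a) < r"
      proof eventually_elim
        case (elim n)
        define h where "h = hs n"
        have h: "0 < h" "h \<le> 1" "h \<le> \<rho>" "h < \<delta>" "h * (C * h) < \<delta>"
          using hs(1) hs_small elim by (auto simp: h_def)
        define \<tau> where "\<tau> = h * (u h a - \<phi> a)"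
        have \<tau>h: "\<bar>\<tau>\<bar> \<le> h * (C * h)"
          unfolding \<tau>_def using u_close[OF a h(1-3)] h by (simp add: abs_mult)
        then have \<tau>\<delta>: "\<bar>\<tau>\<bar> < \<delta>" using h by linarith
        have "sqrt \<bar>\<tau>\<bar> \<le> sqrt (C * h\<^sup>2)"
          using \<tau>h by (simp add: power2_eq_square mult_ac)
        also have "\<dots> = sqrt C * h" using h by (simp add: real_sqrt_mult)
        finally have sq: "sqrt \<bar>\<tau>\<bar> \<le> sqrt C * h" .
        have "\<bar>\<phi> (F h a) - \<phi> a - w a * h\<bar> \<le> \<eta> * (h + sqrt \<bar>\<tau>\<bar>)"
          using \<delta>(2)[OF _ h(4) \<tau>\<delta>] h F_eq[of h a] by (simp add: \<tau>_def)
        also have "\<dots> \<le> \<eta> * (h + sqrt C * h)"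
          using sq \<eta> by (intro mult_left_mono) auto
        also have "\<dots> = \<eta> * (1 + sqrt C) * h" by (simp add: algebra_simps)
        also have "\<dots> < r * h"
        proof -
          have "\<eta> * (1 + sqrt C) < \<eta> * (2 + sqrt C)" using \<eta> by simp
          also have "\<dots> = r"
          proof -
            have "2 + sqrt C \<noteq> 0" using real_sqrt_ge_zero[OF C] by linarith
            then show ?thesis by (simp add: \<eta>_def)
          qed
          finally show ?thesis using h by simp
        qed
        finally have "\<bar>\<phi> (F h a) - \<phi> a - w a * h\<bar> / h < r"
          using h by (simp add: divide_simps)
        moreover have "(\<phi> (F h a) - \<phi> a) / h - w a = (\<phi> (F h a) - \<phi> a - w a * h) / h"
          using h by (simp add: diff_divide_distrib)
        ultimately show ?case using h by (simp add: h_def)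
      qed
      then show "\<exists>no. \<forall>n\<ge>no. norm ((\<phi> (F (hs n) a) - \<phi> a) / hs n - w a) < r"
        by (simp add: eventually_sequentially)
    qed
    have "(\<lambda>n. ((\<phi> (F (hs n) a) - \<phi> a) / hs n) * \<zeta> (F (hs n) a) * (1 + hs n * dv (hs n) a)
        + \<phi> a * ((\<zeta> (F (hs n) a) - \<zeta> a) / hs n)
        + ((\<phi> a - u (hs n) a) / hs n) * \<zeta> (F (hs n) a) * (hs n * dv (hs n) a)
        + u (hs n) a * (hs n * dv (hs n) a) * ((\<zeta> (F (hs n) a) - \<zeta> a) / hs n)
        - (u (hs n) a)\<^sup>2 / 2 * D a ?v)
      \<longlonglongrightarrow> w a * \<zeta> a * (1 + 0) + \<phi> a * D a (X a + \<phi> a *\<^sub>R ?v) + 0 * \<zeta> a * 0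
        + \<phi> a * 0 * D a (X a + \<phi> a *\<^sub>R ?v) - (\<phi> a)\<^sup>2 / 2 * D a ?v"
      by (intro tendsto_intros \<phi>_quot \<zeta>_lim dv_o \<zeta>_quot u_o u_lim) simp
    moreover have "((\<phi> (F (hs n) a) - \<phi> a) / hs n) * \<zeta> (F (hs n) a) * (1 + hs n * dv (hs n) a)
        + \<phi> a * ((\<zeta> (F (hs n) a) - \<zeta> a) / hs n)
        + ((\<phi> a - u (hs n) a) / hs n) * \<zeta> (F (hs n) a) * (hs n * dv (hs n) a)
        + u (hs n) a * (hs n * dv (hs n) a) * ((\<zeta> (F (hs n) a) - \<zeta> a) / hs n)
        - (u (hs n) a)\<^sup>2 / 2 * D a ?v = H (hs n) a" for n
      using hs(1)[of n] by (simp add: H_def)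
    moreover have "w a * \<zeta> a * (1 + 0) + \<phi> a * D a (X a + \<phi> a *\<^sub>R ?v) + 0 * \<zeta> a * 0
        + \<phi> a * 0 * D a (X a + \<phi> a *\<^sub>R ?v) - (\<phi> a)\<^sup>2 / 2 * D a ?v = Hlim a"
    proof -
      have "D a (X a + \<phi> a *\<^sub>R ?v) = D a (X a) + \<phi> a * D a ?v"
        using linear_add[OF has_derivative_linear[OF D[of a]], of "X a" "\<phi> a *\<^sub>R ?v"]
          linear_scale[OF has_derivative_linear[OF D[of a]], of "\<phi> a" ?v] by simp
      then show ?thesis
        by (simp add: Hlim_def J_def power2_eq_square algebra_simps)
    qed
    ultimately show ?thesis by simp
  qed

  have cJ: "continuous_on UNIV J"
  proof -
    have eq: "D a (X a) = D a (e, 0) + (\<Sum>i\<in>Basis. (A (fst a) \<bullet> i) * D a (0, i))" for a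
    proof -
      have lin: "linear (D a)" using D has_derivative_linear by blast
      have "D a (X a) = D a ((e, 0) + (\<Sum>i\<in>Basis. (A (fst a) \<bullet> i) *\<^sub>R (0, i)))"
        by (rule arg_cong[where f = "D a"])
          (simp add: X_def prod_eq_iff fst_sum snd_sum euclidean_representation)
      then show ?thesis
        by (simp add: linear_add[OF lin] linear_sum[OF lin] linear_scale[OF lin] del: scaleR_Pair)
    qed
    show ?thesis
      unfolding J_def eq
      by (intro continuous_intros \<phi> cD continuous_on_compose2[OF cA]) auto
  qed
  have J0: "J a = 0" if "a \<notin> K" for a
    by (simp add: J_def DK[OF that])
  have bJ: "bounded {a. J a \<noteq> 0}"
    by (rule bounded_subset[OF bK]) (use J0 in blast)
  have mH: "H (hs n) \<in> borel_measurable lborel" for n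
  proof -
    have "continuous_on UNIV (H (hs n))"
      unfolding H_def divide_inverse
      by (intro continuous_intros cu cdv \<phi> c\<zeta> cD continuous_on_compose2[OF \<phi> cF]
          continuous_on_compose2[OF c\<zeta> cF]) auto
    then show ?thesis using borel_measurable_continuous_onI by auto
  qed
  have m\<zeta>: "\<zeta> \<in> borel_measurable lebesgue" and mJ: "J \<in> borel_measurable lebesgue"
    using borel_measurable_continuous_onI[OF c\<zeta>] borel_measurable_continuous_onI[OF cJ]
    by (auto intro: measurable_completion)
  have dom: "Hlim \<in> borel_measurable lebesgue"
    "\<And>n. H (hs n) \<in> borel_measurable lebesgue"
    "integrable lebesgue (\<lambda>a. E * indicator K a)"
    "AE a in lebesgue. (\<lambda>n. H (hs n) a) \<longlonglongrightarrow> Hlim a"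
    "\<And>n. AE a in lebesgue. norm (H (hs n) a) \<le> E * indicator K a"
  proof -
    show "Hlim \<in> borel_measurable lebesgue"
      unfolding Hlim_def using w m\<zeta> mJ by measurable
    show "H (hs n) \<in> borel_measurable lebesgue" for n
      using mH by (rule measurable_completion)
    show "integrable lebesgue (\<lambda>a. E * indicator K a)"
    proof (intro integrable_mult_right integrable_real_indicator)
      have "K \<in> lmeasurable" by (rule lmeasurable_compact[OF K])
      then show "K \<in> sets lebesgue" "emeasure lebesgue K < \<infinity>"
        unfolding fmeasurable_def by blast+
    qed
    show "AE a in lebesgue. (\<lambda>n. H (hs n) a) \<longlonglongrightarrow> Hlim a"
      using diff
    proof eventually_elim
      case (elim a)
      show ?case
      proof (cases "a \<in> K")
        case True
        with elim conv show ?thesis by blast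
      next
        case False
        have "\<zeta> a = 0" using \<zeta>K False by blast
        then have "Hlim a = 0" by (simp add: Hlim_def J_def DK[OF False])
        then show ?thesis by (simp add: H_outside[OF False])
      qed
    qed
    show "AE a in lebesgue. norm (H (hs n) a) \<le> E * indicator K a" for n
      using H_bound H_outside by (intro AE_I2) (auto simp: indicator_def)
  qed
  have "(\<lambda>n. integral\<^sup>L lebesgue (H (hs n))) \<longlonglongrightarrow> integral\<^sup>L lebesgue Hlim"
    by (rule integral_dominated_convergence[OF dom])
  moreover have "integral\<^sup>L lebesgue (H (hs n)) = 0" for n
    using H0[of "hs n"] hs(1)[of n] hs_small[of n] integral_completion[OF mH[of n]] by simp
  ultimately have lim0: "integral\<^sup>L lebesgue Hlim = 0"
    by (simp add: LIMSEQ_const_iff)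
  have iJ: "integrable lebesgue J"
    using integrable_continuous_bounded_support(1)[OF cJ bJ] borel_measurable_continuous_onI[OF cJ]
    by (simp add: integrable_completion)
  have iH: "integrable lebesgue Hlim"
    by (rule integrable_dominated_convergence[OF dom])
  have "integral\<^sup>L lebesgue (\<lambda>a. w a * \<zeta> a) = integral\<^sup>L lebesgue (\<lambda>a. Hlim a - J a)"
    by (simp add: Hlim_def)
  also have "\<dots> = - integral\<^sup>L lebesgue J"
    using iH iJ lim0 by simp
  finally show ?thesis
    by (simp add: J_def[abs_def] X_def)
qed

section \<open>The product of the group in graph coordinates\<close>

abbreviation layer1 :: "(real ^ 'k) \<times> (real ^ 'n) \<Rightarrow> real ^ ('k::finite) option" where
  "layer1 a \<equiv> fst (embW a :: ('k, 'n::finite) carnot)"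

text \<open>
  The component in \<^const>\<open>subW\<close> of \<open>a \<cdot> t \<cdot> b\<close>, with \<open>t\<close> read as a point of
  \<^const>\<open>subV\<close>. For \<open>t = \<phi>(a)\<close> it is the base point over which the graph lies after moving
  from the graph point over \<open>a\<close> by the increment \<open>b\<close>.
\<close>

definition graph_shift ::
  "('k::finite, 'n::finite) matrices \<Rightarrow> real \<Rightarrow> (real ^ 'k) \<times> (real ^ 'n) \<Rightarrow> (real ^ 'k) \<times> (real ^ 'n)
    \<Rightarrow> (real ^ 'k) \<times> (real ^ 'n)" where
  "graph_shift B t a b = (fst a + fst b, snd a + snd b +
     (\<chi> s. t * ((B s *v axis None 1) \<bullet> layer1 b) + 1/2 * ((B s *v layer1 a) \<bullet> layer1 b)))"

lemma skew_form:
  fixes B :: "('k::finite, 'n::finite) matrices"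
  assumes "carnot_step2 B"
  shows "(B s *v p) \<bullet> q = - ((B s *v q) \<bullet> p)"
proof -
  have "transpose (B s) = - B s"
    using assms by (simp add: carnot_step2_def)
  then have "(B s *v p) \<bullet> q = p \<bullet> ((- B s) *v q)"
    by (metis dot_lmul_matrix inner_commute matrix_vector_mul_assoc transpose_matrix_vector vector_transpose_matrix)
  then show ?thesis
    by (simp add: matrix_vector_mult_def inner_vec_def sum_negf mult.commute)
qed

lemma skew_form_self:
  fixes B :: "('k::finite, 'n::finite) matrices"
  assumes "carnot_step2 B"
  shows "(B s *v p) \<bullet> p = 0"
  using skew_form[OF assms, of s p p] by simp

lemma embW_in_subW [simp]: "embW a \<in> subW"
  by (simp add: subW_def embW_def)

lemma embV_in_subV [simp]: "embV t \<in> subV"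
  by (simp add: subV_def embV_def axis_def)

lemma subW_range: "subW = range embW"
proof -
  have "p = embW (\<chi> j. fst p $ Some j, snd p)" if "p \<in> subW" for p :: "('a, 'b) carnot"
    using that by (auto simp: subW_def embW_def prod_eq_iff vec_eq_iff split: option.splits)
  then show ?thesis by (auto intro: range_eqI)
qed

lemma subV_range: "subV = range embV"
proof -
  have "fst p = axis None (fst p $ None)" if "p \<in> subV" for p :: "('a, 'b) carnot"
    unfolding vec_eq_iff
  proof
    fix i show "fst p $ i = axis None (fst p $ None) $ i"
      using that by (cases i) (auto simp: subV_def axis_def)
  qed
  then have "p = embV (fst p $ None)" if "p \<in> subV" for p :: "('a, 'b) carnot"
    using that by (auto simp: subV_def embV_def prod_eq_iff)
  then show ?thesis by (auto intro: range_eqI)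
qed

lemma embV_inject [simp]: "embV s = (embV t :: ('k::finite, 'n::finite) carnot) \<longleftrightarrow> s = t"
  by (auto simp: embV_def axis_eq_axis)

lemma embW_inject [simp]: "embW a = (embW b :: ('k::finite, 'n::finite) carnot) \<longleftrightarrow> a = b"
proof
  assume "embW a = (embW b :: ('k, 'n) carnot)"
  then have "fst (embW a :: ('k, 'n) carnot) $ Some j = fst (embW b :: ('k, 'n) carnot) $ Some j" "snd a = snd b" for j
    by (simp_all add: embW_def)
  then show "a = b" by (simp add: embW_def prod_eq_iff vec_eq_iff)
qed simp

lemma gmul_cancel:
  assumes "w \<in> subW" "v \<in> subV" "w' \<in> subW" "v' \<in> subV" "gmul B w v = gmul B w' v'"
  shows "w = w'" "v = v'"
  using decomposition_unique[of "gmul B w v" B] assms by blast+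

lemma proj_gmul:
  assumes "w \<in> subW" "v \<in> subV"
  shows "projW B (gmul B w v) = w" "projV B (gmul B w v) = v"
  unfolding projW_def projV_def using assms gmul_cancel[OF assms] by (blast intro!: the_equality)+

lemma gmul_ginv_cancel:
  fixes B :: "('k::finite, 'n::finite) matrices"
  assumes "carnot_step2 B"
  shows "gmul B p (gmul B (ginv p) q) = q" "gmul B (ginv p) (gmul B p q) = q"
proof -
  have neg: "B s *v (- x) = - (B s *v x)" for s x
    by (rule linear_neg[OF matrix_vector_mul_linear])
  show "gmul B p (gmul B (ginv p) q) = q" "gmul B (ginv p) (gmul B p q) = q"
    by (simp_all add: gmul_def ginv_def prod_eq_iff vec_eq_iff[where 'b = 'n] inner_add_right
        inner_diff_right neg skew_form_self[OF assms] field_simps)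
qed

lemma linear_layer1: "linear layer1"
  by (rule linearI) (auto simp: embW_def vec_eq_iff split: option.splits)

text \<open>
  Conjugating \<open>b\<close> by \<open>embV t\<close> adds the commutator \<open>t \<langle>B e\<^sub>1, b\<rangle>\<close> to the second layer;
  by skew-symmetry the two halves of it that arise on either side of the equation combine.
\<close>

lemma gmul_shift:
  fixes B :: "('k::finite, 'n::finite) matrices"
  assumes "carnot_step2 B"
  shows "gmul B (gmul B (embW a) (embV t)) (gmul B (embW b) (embV r)) =
    gmul B (embW (graph_shift B t a b)) (embV (t + r))"
proof -
  have ax: "axis None s = s *\<^sub>R (axis None 1 :: real ^ 'k option)" for s
    by (simp add: vec_eq_iff axis_def)
  have l: "layer1 (graph_shift B t a b) = layer1 a + layer1 b"
    by (auto simp: graph_shift_def embW_def vec_eq_iff split: option.splits)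
  have sW: "snd (embW c :: ('k, 'n) carnot) = snd c" for c by (simp add: embW_def)
  let ?e = "axis None 1 :: real ^ 'k option"
  have 1: "(B s *v layer1 b) \<bullet> ?e = - ((B s *v ?e) \<bullet> layer1 b)" for s
    by (rule skew_form[OF assms])
  show ?thesis
  proof (rule prod_eqI)
    show "snd (gmul B (gmul B (embW a) (embV t)) (gmul B (embW b) (embV r))) =
      snd (gmul B (embW (graph_shift B t a b)) (embV (t + r)))"
      unfolding vec_eq_iff
    proof
      fix s
      show "snd (gmul B (gmul B (embW a) (embV t)) (gmul B (embW b) (embV r))) $ s =
        snd (gmul B (embW (graph_shift B t a b)) (embV (t + r))) $ s"
        unfolding gmul_def embV_def fst_conv snd_conv l sW
        unfolding ax[of t] ax[of r] ax[of "t + r"]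
        by (simp add: graph_shift_def matrix_vector_right_distrib inner_add_left inner_add_right
            matrix_vector_mult_scaleR skew_form_self[OF assms] 1 algebra_simps)
    qed
  qed (simp add: gmul_def l embV_def vec_eq_iff axis_def)
qed

lemma graph_shift_solve:
  obtains b where "graph_shift B t a b = a'"
    and "b = (fst a' - fst a, snd a' - snd a - (\<chi> s. t * ((B s *v axis None 1) \<bullet> layer1 (a' - a))
      + 1/2 * ((B s *v layer1 a) \<bullet> layer1 (a' - a))))"
proof
  let ?b = "(fst a' - fst a, snd a' - snd a - (\<chi> s. t * ((B s *v axis None 1) \<bullet> layer1 (a' - a))
      + 1/2 * ((B s *v layer1 a) \<bullet> layer1 (a' - a))))"
  have "layer1 ?b = layer1 (a' - a)"
    by (auto simp: embW_def vec_eq_iff split: option.splits)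
  then show "graph_shift B t a ?b = a'"
    by (simp add: graph_shift_def prod_eq_iff)
qed simp

lemma hnorm_embV [simp]: "hnorm eps (embV t) = \<bar>t\<bar>"
  by (simp add: hnorm_def embV_def norm_eq_sqrt_inner inner_axis_axis)

lemma norm_layer1: "norm (layer1 b) = norm (fst b)"
proof -
  have "(\<Sum>i\<in>UNIV. (layer1 b $ i)\<^sup>2) = (\<Sum>j\<in>UNIV. (fst b $ j)\<^sup>2)"
    by (simp add: UNIV_option_conv sum.reindex embW_def)
  then show ?thesis by (simp add: norm_vec_def L2_set_def)
qed

lemma hnorm_embW: "hnorm eps (embW b) = max (norm (fst b)) (eps * sqrt (norm (snd b)))"
  unfolding hnorm_def norm_layer1 by (simp add: embW_def)

lemma igraph_eq:
  assumes "U \<subseteq> subW" "\<And>a. embW a \<in> U \<Longrightarrow> f (embW a) = embV (\<phi> a)"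
  shows "igraph B U f = {gmul B (embW a) (embV (\<phi> a)) | a. embW a \<in> U}"
proof (intro equalityI subsetI)
  fix p assume "p \<in> igraph B U f"
  then obtain u where u: "u \<in> U" "p = gmul B u (f u)"
    by (auto simp: igraph_def)
  then obtain a where "u = embW a"
    using assms(1) subW_range by blast
  with u assms(2)[of a] have "embW a \<in> U" "p = gmul B (embW a) (embV (\<phi> a))"
    by simp_all
  then show "p \<in> {gmul B (embW a) (embV (\<phi> a)) | a. embW a \<in> U}" by blast
next
  fix p assume "p \<in> {gmul B (embW a) (embV (\<phi> a)) | a. embW a \<in> U}"
  then obtain a where "embW a \<in> U" "p = gmul B (embW a) (f (embW a))"
    using assms(2) by auto
  then show "p \<in> igraph B U f"
    unfolding igraph_def by blast
qed

section \<open>Intrinsic Lipschitz functions\<close>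

text \<open>
  The cone at \<open>p = a \<cdot> \<phi>(a)\<close> consists of the points \<open>p \<cdot> b \<cdot> r\<close> with
  \<open>\<parallel>b\<parallel> \<le> |r| / C\<^sub>1\<close>, and a graph point has this form with \<open>r\<close> the increment of \<open>\<phi>\<close>. As the
  graph meets the cone only in \<open>p\<close>, the reverse inequality holds; \<open>C + 1\<close> serves as \<open>C\<^sub>1 > C\<close>.
\<close>

lemma intrinsic_lipschitz_estimate:
  fixes B :: "('k::finite, 'n::finite) matrices"
  assumes B: "carnot_step2 B" and lip: "intrinsic_lipschitz_with eps B C U f"
    and U: "U \<subseteq> subW" and f: "\<And>a. embW a \<in> U \<Longrightarrow> f (embW a) = embV (\<phi> a)"
    and a: "embW a \<in> U" and a': "embW (graph_shift B (\<phi> a) a b) \<in> U"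
  shows "\<bar>\<phi> (graph_shift B (\<phi> a) a b) - \<phi> a\<bar> \<le> (C + 1) * hnorm eps (embW b :: ('k, 'n) carnot)"
proof (rule ccontr)
  define r where "r = \<phi> (graph_shift B (\<phi> a) a b) - \<phi> a"
  define p where "p = gmul B (embW a) (embV (\<phi> a))"
  define q where "q = gmul B p (gmul B (embW b) (embV r))"
  assume "\<not> ?thesis"
  then have less: "(C + 1) * hnorm eps (embW b :: ('k, 'n) carnot) < \<bar>r\<bar>" by (simp add: r_def)
  have C: "C \<ge> 0" using lip by (simp add: intrinsic_lipschitz_with_def)
  have q: "q = gmul B (embW (graph_shift B (\<phi> a) a b)) (embV (\<phi> (graph_shift B (\<phi> a) a b)))"
    by (simp add: q_def p_def gmul_shift[OF B] r_def)
  have graph: "igraph B U f = {gmul B (embW a) (embV (\<phi> a)) | a. embW a \<in> U}"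
    by (rule igraph_eq) (use U f in auto)
  have pg: "p \<in> igraph B U f" and qg: "q \<in> igraph B U f"
    unfolding graph p_def q using a a' by blast+
  have "hnorm eps (embW b :: ('k, 'n) carnot) \<le> 1 / (C + 1) * \<bar>r\<bar>"
    using less C by (simp add: field_simps)
  then have "q \<in> icone eps B p (1 / (C + 1))"
    unfolding icone_def q_def by (intro imageI) (simp add: proj_gmul)
  moreover have "icone eps B p (1 / (C + 1)) \<inter> igraph B U f = {p}"
    using lip pg less_add_one[of C] unfolding intrinsic_lipschitz_with_def by blast
  ultimately have "q = p"
    using qg by blast
  then have "\<phi> (graph_shift B (\<phi> a) a b) = \<phi> a"
    unfolding q p_def using gmul_cancel(2)[of _ _ _ _ B] by (metis embV_in_subV embW_in_subW embV_inject)
  then have "r = 0" by (simp add: r_def)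
  moreover have "0 \<le> hnorm eps (embW b :: ('k, 'n) carnot)"
    by (simp add: hnorm_def le_max_iff_disj)
  ultimately show False using less C by (simp add: mult_less_0_iff)
qed

lemma open_vimage_embW:
  assumes "openin (top_of_set subW) U"
  shows "open (embW -` U :: ((real ^ 'k::finite) \<times> (real ^ 'n::finite)) set)"
proof -
  obtain T where T: "open T" "U = subW \<inter> T"
    using assms by (auto simp: openin_open)
  have c1: "continuous_on UNIV (layer1 :: (real ^ 'k) \<times> (real ^ 'n) \<Rightarrow> _)"
    using linear_continuous_on[OF linear_conv_bounded_linear[THEN iffD1, OF linear_layer1]] .
  have "continuous_on UNIV (\<lambda>a :: (real ^ 'k) \<times> (real ^ 'n). (layer1 a, snd a))"
    by (rule continuous_on_Pair[OF c1 continuous_on_snd[OF continuous_on_id]])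
  then have "continuous_on UNIV (embW :: (real ^ 'k) \<times> (real ^ 'n) \<Rightarrow> _)"
    by (rule continuous_on_eq) (simp add: embW_def)
  then have "open (embW -` T :: ((real ^ 'k) \<times> (real ^ 'n)) set)"
    using T(1) by (simp add: continuous_on_open_vimage)
  moreover have "embW -` U = (embW -` T :: ((real ^ 'k) \<times> (real ^ 'n)) set)"
    using T(2) by (auto simp: subW_range)
  ultimately show ?thesis by simp
qed

lemma locally_intrinsic_lipschitz_estimate:
  fixes B :: "('k::finite, 'n::finite) matrices"
  assumes B: "carnot_step2 B" and U: "openin (top_of_set subW) U"
    and lip: "locally_intrinsic_lipschitz eps B U f"
    and f: "\<And>a. embW a \<in> U \<Longrightarrow> f (embW a) = embV (\<phi> a)"
    and a0: "embW a0 \<in> U"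
  shows "\<exists>G C. open G \<and> a0 \<in> G \<and> C \<ge> 0 \<and> (\<forall>a b. a \<in> G \<longrightarrow> graph_shift B (\<phi> a) a b \<in> G \<longrightarrow>
    \<bar>\<phi> (graph_shift B (\<phi> a) a b) - \<phi> a\<bar> \<le> C * hnorm eps (embW b :: ('k, 'n) carnot))"
proof -
  obtain N C where N: "openin (top_of_set U) N" "embW a0 \<in> N" "intrinsic_lipschitz_with eps B C N f"
    using lip a0 unfolding locally_intrinsic_lipschitz_def by blast
  have N': "openin (top_of_set subW) N"
    using openin_trans[OF N(1) U] .
  have sub: "N \<subseteq> U" "N \<subseteq> subW"
    using N(1) N' openin_imp_subset by blast+
  have C: "C \<ge> 0" using N(3) by (simp add: intrinsic_lipschitz_with_def)
  show ?thesis
  proof (intro exI[of _ "embW -` N"] exI[of _ "C + 1"] conjI allI impI)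
    show "open (embW -` N :: ((real ^ 'k) \<times> (real ^ 'n)) set)" by (rule open_vimage_embW[OF N'])
    fix a b assume "a \<in> embW -` N" "graph_shift B (\<phi> a) a b \<in> embW -` N"
    then show "\<bar>\<phi> (graph_shift B (\<phi> a) a b) - \<phi> a\<bar> \<le> (C + 1) * hnorm eps (embW b :: ('k, 'n) carnot)"
      using f sub by (intro intrinsic_lipschitz_estimate[OF B N(3) sub(2)]) auto
  qed (use N C in auto)
qed

text \<open>
  For a fixed base point \<open>a\<close>, the homogeneous norm of the increment \<open>b\<close> that leads to \<open>a'\<close>
  tends to 0 as \<open>a'\<close> tends to \<open>a\<close>, though only like a square root in the second layer.
\<close>

lemma intrinsic_lipschitz_continuous:
  fixes B :: "('k::finite, 'n::finite) matrices"
  assumes B: "carnot_step2 B" and U: "openin (top_of_set subW) U"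
    and lip: "locally_intrinsic_lipschitz eps B U f"
    and f: "\<And>a. embW a \<in> U \<Longrightarrow> f (embW a) = embV (\<phi> a)"
  shows "continuous_on (embW -` U) \<phi>"
proof (rule continuous_at_imp_continuous_on, rule ballI)
  fix a assume "a \<in> embW -` U"
  then have "embW a \<in> U" by simp
  from locally_intrinsic_lipschitz_estimate[OF B U lip f this]
  obtain G C where G: "open G" "a \<in> G" "C \<ge> 0" and
    est: "\<And>b. graph_shift B (\<phi> a) a b \<in> G \<Longrightarrow>
      \<bar>\<phi> (graph_shift B (\<phi> a) a b) - \<phi> a\<bar> \<le> C * hnorm eps (embW b :: ('k, 'n) carnot)" by blast
  define d where "d a' = (fst a' - fst a, snd a' - snd a - (\<chi> s. \<phi> a * ((B s *v axis None 1) \<bullet> layer1 (a' - a))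
      + 1/2 * ((B s *v layer1 a) \<bullet> layer1 (a' - a))))" for a'
  have tl: "((\<lambda>a'. layer1 (a' - a)) \<longlongrightarrow> layer1 (a - a)) (at a)"
    by (rule bounded_linear.tendsto[OF linear_conv_bounded_linear[THEN iffD1, OF linear_layer1]])
      (intro tendsto_intros)
  have l0: "layer1 (0 :: (real ^ 'k) \<times> (real ^ 'n)) = 0"
    using linear_0[OF linear_layer1] .
  have "((\<lambda>a'. C * hnorm eps (embW (d a') :: ('k, 'n) carnot)) \<longlongrightarrow> C * max (norm (fst a - fst a)) (eps * sqrt (norm (snd a - snd a - (\<chi> s. \<phi> a * ((B s *v axis None 1) \<bullet> layer1 (a - a))
      + 1/2 * ((B s *v layer1 a) \<bullet> layer1 (a - a))))))) (at a)"
    unfolding hnorm_embW d_def fst_conv snd_conv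
    by (intro tendsto_intros tl)
  then have lim: "((\<lambda>a'. C * hnorm eps (embW (d a') :: ('k, 'n) carnot)) \<longlongrightarrow> 0) (at a)"
    by (simp add: l0 zero_vec_def[symmetric])
  have ev: "\<forall>\<^sub>F a' in at a. norm (\<phi> a' - \<phi> a) \<le> C * hnorm eps (embW (d a') :: ('k, 'n) carnot)"
  proof -
    have "\<forall>\<^sub>F a' in at a. a' \<in> G"
      using G by (auto simp: eventually_at_topological)
    then show ?thesis
    proof eventually_elim
      case (elim a')
      have "graph_shift B (\<phi> a) a (d a') = a'"
        unfolding d_def by (rule graph_shift_solve[of B "\<phi> a" a a']) simp
      with est[of "d a'"] elim show ?case by simp
    qed
  qed
  have "((\<lambda>a'. \<phi> a' - \<phi> a) \<longlongrightarrow> 0) (at a)"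
    by (rule Lim_null_comparison[OF ev lim])
  then show "isCont \<phi> a"
    by (simp add: isCont_def LIM_zero_iff)
qed

text \<open>
  The local constants belong to neighbourhoods, and the estimate needs both points in
  the same one. A Lebesgue number of a finite subcover provides this for all sufficiently close
  points.
\<close>

lemma intrinsic_lipschitz_uniform_on_compact:
  fixes B :: "('k::finite, 'n::finite) matrices"
  assumes B: "carnot_step2 B" and U: "openin (top_of_set subW) U"
    and lip: "locally_intrinsic_lipschitz eps B U f"
    and f: "\<And>a. embW a \<in> U \<Longrightarrow> f (embW a) = embV (\<phi> a)"
    and K: "compact K" "K \<subseteq> embW -` U"
  obtains C \<delta> where "C \<ge> 0" "\<delta> > 0"
    "\<And>a b. a \<in> K \<Longrightarrow> dist a (graph_shift B (\<phi> a) a b) < \<delta> \<Longrightarrow>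
      \<bar>\<phi> (graph_shift B (\<phi> a) a b) - \<phi> a\<bar> \<le> C * hnorm eps (embW b :: ('k, 'n) carnot)"
proof -
  define good where "good G C \<longleftrightarrow> C \<ge> 0 \<and> (\<forall>a b. a \<in> G \<longrightarrow> graph_shift B (\<phi> a) a b \<in> G \<longrightarrow>
    \<bar>\<phi> (graph_shift B (\<phi> a) a b) - \<phi> a\<bar> \<le> C * hnorm eps (embW b :: ('k, 'n) carnot))" for G C
  have cover: "K \<subseteq> \<Union>{G. open G \<and> (\<exists>C. good G C)}"
  proof
    fix a assume "a \<in> K"
    then have "embW a \<in> U" using K(2) by auto
    from locally_intrinsic_lipschitz_estimate[OF B U lip f this]
    show "a \<in> \<Union>{G. open G \<and> (\<exists>C. good G C)}"
      unfolding good_def by auto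
  qed
  then obtain \<G> where \<G>: "\<G> \<subseteq> {G. open G \<and> (\<exists>C. good G C)}" "finite \<G>" "K \<subseteq> \<Union>\<G>"
    using compactE[OF K(1) cover] by auto
  then have "\<forall>G\<in>\<G>. \<exists>C. good G C" by blast
  from bchoice[OF this] obtain c where c: "\<And>G. G \<in> \<G> \<Longrightarrow> good G (c G)"
    by blast
  have "open G" if "G \<in> \<G>" for G using that \<G>(1) by blast
  from Heine_Borel_lemma[OF K(1) \<G>(3) this]
  obtain \<delta> where \<delta>: "\<delta> > 0" "\<And>a. a \<in> K \<Longrightarrow> \<exists>G\<in>\<G>. ball a \<delta> \<subseteq> G"
    by metis
  show ?thesis
  proof (rule that[of "sum c \<G>" \<delta>])
    have c0: "c G \<ge> 0" if "G \<in> \<G>" for G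
      using c[OF that] by (simp add: good_def)
    then show "0 \<le> sum c \<G>" by (rule sum_nonneg)
    fix a b assume a: "a \<in> K" and d: "dist a (graph_shift B (\<phi> a) a b) < \<delta>"
    obtain G where G: "G \<in> \<G>" "ball a \<delta> \<subseteq> G" using \<delta>(2)[OF a] by blast
    have "a \<in> G" "graph_shift B (\<phi> a) a b \<in> G"
      using subsetD[OF G(2), of a] subsetD[OF G(2), of "graph_shift B (\<phi> a) a b"] d \<delta>(1)
      by simp_all
    then have "\<bar>\<phi> (graph_shift B (\<phi> a) a b) - \<phi> a\<bar> \<le> c G * hnorm eps (embW b :: ('k, 'n) carnot)"
      using c[OF G(1)] unfolding good_def by blast
    also have "\<dots> \<le> sum c \<G> * hnorm eps (embW b :: ('k, 'n) carnot)"
      using member_le_sum[OF G(1), of c] c0 \<G>(2)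
      by (intro mult_right_mono) (auto simp: hnorm_def le_max_iff_disj)
    finally show "\<bar>\<phi> (graph_shift B (\<phi> a) a b) - \<phi> a\<bar> \<le> sum c \<G> * hnorm eps (embW b :: ('k, 'n) carnot)" .
  qed (rule \<delta>(1))
qed

section \<open>Intrinsic differentials\<close>

lemma embV_ginv_gmul:
  fixes B :: "('k::finite, 'n::finite) matrices"
  assumes "carnot_step2 B"
  shows "gmul B (ginv (embV s)) (embV t) = embV (t - s)"
proof -
  have ax: "axis None r = r *\<^sub>R (axis None 1 :: real ^ 'k option)" for r
    by (simp add: vec_eq_iff axis_def)
  have "(B i *v (- axis None s)) \<bullet> axis None t = 0" for i
    unfolding ax[of s] ax[of t]
    by (simp add: scaleR_minus_left[symmetric] matrix_vector_mult_scaleR skew_form_self[OF assms]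
        del: scaleR_minus_left)
  then show ?thesis
    by (simp add: gmul_def ginv_def embV_def prod_eq_iff vec_eq_iff axis_def)
qed

text \<open>
  The translated graph \<open>p\<^sup>-\<^sup>1 \<cdot> graph\<close> is the graph of
  \<open>b \<mapsto> \<phi>(a') - \<phi>(a)\<close>, where \<open>a'\<close> is the graph shift of \<open>a\<close> by \<open>b\<close>; on \<^const>\<open>subV\<close>
  the group operation is addition of reals. So the intrinsic differential is a first-order
  expansion with the homogeneous norm as gauge.
\<close>

lemma intrinsic_differential_estimate:
  fixes B :: "('k::finite, 'n::finite) matrices"
  assumes B: "carnot_step2 B" and U: "U \<subseteq> subW"
    and f: "\<And>a. embW a \<in> U \<Longrightarrow> f (embW a) = embV (\<phi> a)"
    and df: "intrinsic_differential eps B U f (embW a) l"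
    and l: "\<And>x y. l (embW (x, y)) = embV (\<Sum>j\<in>UNIV. c $ j * x $ j)"
    and \<eta>: "\<eta> > 0"
  shows "\<exists>\<delta>>0. \<forall>b. embW (graph_shift B (\<phi> a) a b) \<in> U \<longrightarrow> 0 < hnorm eps (embW b :: ('k, 'n) carnot) \<longrightarrow>
    hnorm eps (embW b :: ('k, 'n) carnot) < \<delta> \<longrightarrow>
    \<bar>\<phi> (graph_shift B (\<phi> a) a b) - \<phi> a - (\<Sum>j\<in>UNIV. c $ j * fst b $ j)\<bar> \<le> \<eta> * hnorm eps (embW b :: ('k, 'n) carnot)"
proof -
  have a: "embW a \<in> U" using df by (simp add: intrinsic_differential_def)
  have graph: "igraph B U f = {gmul B (embW a) (embV (\<phi> a)) | a. embW a \<in> U}"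
    by (rule igraph_eq) (use U f in auto)
  define p where "p = gmul B (embW a) (embV (\<phi> a))"
  define S where "S = gmul B (ginv p) ` igraph B U f"
  define q where "q b = ennreal (hnorm eps (gmul B (ginv (l b)) (graph_fun B S b)) / hnorm eps b)" for b
  have lim: "((\<lambda>r. SUP b\<in>{b \<in> graph_dom B S. 0 < hnorm eps b \<and> hnorm eps b < r}. q b) \<longlongrightarrow> 0) (at_right 0)"
    using df unfolding intrinsic_differential_def Let_def f[OF a] p_def[symmetric] S_def[symmetric] q_def[symmetric]
    by simp
  have "\<forall>\<^sub>F r in at_right 0. (SUP b\<in>{b \<in> graph_dom B S. 0 < hnorm eps b \<and> hnorm eps b < r}. q b) < ennreal \<eta>"
    using order_tendstoD(2)[OF lim] \<eta> by simp
  then have "\<forall>\<^sub>F r in at_right 0. 0 < r \<and> (SUP b\<in>{b \<in> graph_dom B S. 0 < hnorm eps b \<and> hnorm eps b < r}. q b) < ennreal \<eta>"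
    using eventually_at_right_less[of 0] by eventually_elim auto
  then obtain \<delta> where \<delta>: "\<delta> > 0"
    "(SUP b\<in>{b \<in> graph_dom B S. 0 < hnorm eps b \<and> hnorm eps b < \<delta>}. q b) < ennreal \<eta>"
    using eventually_happens[of _ "at_right (0::real)"] trivial_limit_at_right_real by blast
  show ?thesis
  proof (intro exI[of _ \<delta>] conjI allI impI)
    fix b assume b: "embW (graph_shift B (\<phi> a) a b) \<in> U" "0 < hnorm eps (embW b :: ('k, 'n) carnot)"
      "hnorm eps (embW b :: ('k, 'n) carnot) < \<delta>"
    define r where "r = \<phi> (graph_shift B (\<phi> a) a b) - \<phi> a"
    have shift: "gmul B p (gmul B (embW b) (embV r)) = gmul B (embW (graph_shift B (\<phi> a) a b)) (embV (\<phi> (graph_shift B (\<phi> a) a b)))"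
      by (simp add: p_def gmul_shift[OF B] r_def)
    have memS: "gmul B (embW b) v \<in> S \<longleftrightarrow> gmul B p (gmul B (embW b) v) \<in> igraph B U f" for v
      unfolding S_def using gmul_ginv_cancel[OF B] by (metis (no_types, lifting) image_iff)
    have inS: "gmul B (embW b) (embV r) \<in> S"
      unfolding memS shift graph using b(1) by blast
    have val: "graph_fun B S (embW b) = embV r"
      unfolding graph_fun_def
    proof (rule the_equality)
      fix v assume v: "v \<in> subV \<and> gmul B (embW b) v \<in> S"
      then obtain t where t: "v = embV t" by (auto simp: subV_range)
      have "gmul B p (gmul B (embW b) (embV t)) \<in> igraph B U f"
        using v memS t by simp
      then obtain a' where a': "gmul B (embW (graph_shift B (\<phi> a) a b)) (embV (\<phi> a + t)) = gmul B (embW a') (embV (\<phi> a'))"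
        unfolding p_def gmul_shift[OF B] graph by blast
      have "graph_shift B (\<phi> a) a b = a'" "\<phi> a + t = \<phi> a'"
        using gmul_cancel[OF embW_in_subW embV_in_subV embW_in_subW embV_in_subV a'] by simp_all
      then show "v = embV r" by (simp add: t r_def)
    qed (use inS in simp)
    have "embW b \<in> graph_dom B S"
      unfolding graph_dom_def using inS embV_in_subV embW_in_subW by blast
    then have "q (embW b) \<le> (SUP b\<in>{b \<in> graph_dom B S. 0 < hnorm eps b \<and> hnorm eps b < \<delta>}. q b)"
      using b by (intro SUP_upper) auto
    also note \<delta>(2)
    finally have "q (embW b) < ennreal \<eta>" .
    moreover have "q (embW b) = ennreal (\<bar>r - (\<Sum>j\<in>UNIV. c $ j * fst b $ j)\<bar> / hnorm eps (embW b :: ('k, 'n) carnot))"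
      using l[of "fst b" "snd b"] by (simp add: q_def val embV_ginv_gmul[OF B])
    ultimately have "\<bar>r - (\<Sum>j\<in>UNIV. c $ j * fst b $ j)\<bar> / hnorm eps (embW b :: ('k, 'n) carnot) < \<eta>"
      using \<eta> by (simp add: ennreal_less_iff b(2) less_imp_le)
    then show "\<bar>\<phi> (graph_shift B (\<phi> a) a b) - \<phi> a - (\<Sum>j\<in>UNIV. c $ j * fst b $ j)\<bar> \<le> \<eta> * hnorm eps (embW b :: ('k, 'n) carnot)"
      using b(2) by (simp add: r_def divide_simps)
  qed (rule \<delta>(1))
qed

text \<open>
  Closure under products gives \<open>f(a \<cdot> f(a) b f(a)\<^sup>-\<^sup>1) = f(a) + f(b)\<close> and
  closure under dilations gives \<open>f(r x, r\<^sup>2 y) = r f(x, y)\<close>. On the second layer the first is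
  additivity in \<open>y\<close>, so \<open>4 f(0, y) = f(0, 4 y) = 2 f(0, y)\<close> and \<open>f(0, y) = 0\<close>. Hence \<open>f\<close>
  depends on \<open>x\<close> only and is linear.
\<close>

lemma intrinsic_linear_form:
  fixes B :: "('k::finite, 'n::finite) matrices"
  assumes B: "carnot_step2 B" and l: "intrinsic_linear B l"
  obtains c where "\<And>x y. l (embW (x, y)) = embV (\<Sum>j\<in>UNIV. c $ j * x $ j)"
proof -
  have lV: "l (embW a) \<in> subV" for a
    using l by (auto simp: intrinsic_linear_def)
  then have "\<forall>a. \<exists>t. l (embW a) = embV t"
    by (auto simp: subV_range)
  then obtain f where f: "\<And>a. l (embW a) = embV (f a)" by metis
  define S where "S = igraph B subW l"
  have S: "S = {gmul B (embW a) (embV (f a)) | a. True}"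
    unfolding S_def using igraph_eq[of subW l f B] f by simp
  have hS: "homogeneous_subgroup B S" using l by (simp add: intrinsic_linear_def S_def)
  have add: "f (graph_shift B (f a) a b) = f a + f b" for a b
  proof -
    have "gmul B (gmul B (embW a) (embV (f a))) (gmul B (embW b) (embV (f b))) \<in> S"
      using hS unfolding homogeneous_subgroup_def S by blast
    then obtain a' where a': "gmul B (embW (graph_shift B (f a) a b)) (embV (f a + f b)) = gmul B (embW a') (embV (f a'))"
      unfolding gmul_shift[OF B] S by blast
    show ?thesis
      using gmul_cancel[OF embW_in_subW embV_in_subV embW_in_subW embV_in_subV a'] by simp
  qed
  have dil: "f (r *\<^sub>R x, r\<^sup>2 *\<^sub>R y) = r * f (x, y)" if r: "r > 0" for r x y
  proof -
    have "dil r (gmul B (embW (x, y)) (embV (f (x, y)))) \<in> S"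
      using hS r unfolding homogeneous_subgroup_def S by blast
    moreover have "dil r (gmul B (embW (x, y)) (embV (f (x, y)))) =
        gmul B (embW (r *\<^sub>R x, r\<^sup>2 *\<^sub>R y)) (embV (r * f (x, y)))"
    proof -
      have 1: "layer1 (r *\<^sub>R x, r\<^sup>2 *\<^sub>R y) = r *\<^sub>R layer1 (x, y)"
        by (auto simp: embW_def vec_eq_iff split: option.splits)
      have 2: "axis None (r * f (x, y)) = r *\<^sub>R (axis None (f (x, y)) :: real ^ 'k option)"
        by (simp add: vec_eq_iff axis_def)
      have 3: "snd (embW c :: ('k, 'n) carnot) = snd c" for c by (simp add: embW_def)
      show ?thesis
        unfolding dil_def gmul_def embV_def fst_conv snd_conv 1 2 3
        by (simp add: vec_eq_iff matrix_vector_mult_scaleR power2_eq_square algebra_simps)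
    qed
    ultimately obtain a' where a': "gmul B (embW (r *\<^sub>R x, r\<^sup>2 *\<^sub>R y)) (embV (r * f (x, y))) = gmul B (embW a') (embV (f a'))"
      unfolding S by auto
    show ?thesis
      using gmul_cancel[OF embW_in_subW embV_in_subV embW_in_subW embV_in_subV a'] by simp
  qed
  have l0: "layer1 (0, y) = 0" for y :: "real ^ 'n"
    by (auto simp: embW_def vec_eq_iff split: option.splits)
  have addy: "f (x, y + y') = f (x, y) + f (0, y')" for x y y'
    using add[of "(x, y)" "(0, y')"] by (simp add: graph_shift_def l0 zero_vec_def[symmetric])
  have y0: "f (0, y) = 0" for y
  proof -
    have four: "(2::real)\<^sup>2 *\<^sub>R y = (y + y) + (y + y)" by (simp add: vec_eq_iff)
    have "f (0, (y + y) + (y + y)) = 2 * f (0, y)" using dil[of 2 0 y] unfolding four by simp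
    then show ?thesis by (simp only: addy)
  qed
  define g where "g x = f (x, 0)" for x
  have fg: "f (x, y) = g x" for x y
    using addy[of x 0 y] by (simp add: g_def y0)
  have g_add: "g (x + x') = g x + g x'" for x x'
    using add[of "(x, 0)" "(x', 0)"] by (simp add: graph_shift_def fg)
  have g_scale: "g (r *\<^sub>R x) = r *\<^sub>R g x" for r x
  proof -
    have pos: "g (r *\<^sub>R x) = r * g x" if "r > 0" for r x
      using dil[OF that, of x 0] by (simp add: fg)
    have g0: "g 0 = 0" using g_add[of 0 0] by simp
    have neg: "g (- x) = - g x" for x using g_add[of x "- x"] g0 by simp
    consider "r > 0" | "r = 0" | "- r > 0" by linarith
    then show ?thesis
    proof cases
      case 3
      have "g (r *\<^sub>R x) = - g (- (r *\<^sub>R x))" using neg[of "r *\<^sub>R x"] by simp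
      also have "\<dots> = - g ((- r) *\<^sub>R x)" by simp
      also have "\<dots> = - ((- r) * g x)" using pos[OF 3] by simp
      finally show ?thesis by simp
    qed (use pos g0 in auto)
  qed
  have g_lin: "linear g" by (rule linearI[OF g_add g_scale])
  show ?thesis
  proof (rule that[of "\<chi> j. g (axis j 1)"])
    fix x :: "real ^ 'k" and y :: "real ^ 'n"
    have "x = (\<Sum>j\<in>UNIV. x $ j *\<^sub>R axis j 1)"
      by (simp add: vec_eq_iff axis_def if_distrib cong: if_cong)
    then have "g x = g (\<Sum>j\<in>UNIV. x $ j *\<^sub>R axis j 1)" by simp
    also have "\<dots> = (\<Sum>j\<in>UNIV. x $ j * g (axis j 1))"
      by (simp add: linear_sum[OF g_lin] linear_scale[OF g_lin])
    finally show "l (embW (x, y)) = embV (\<Sum>j\<in>UNIV. (\<chi> j. g (axis j 1)) $ j * x $ j)"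
      by (simp add: f fg mult.commute)
  qed
qed

text \<open>
  Increments in a coordinate direction together with a multiple of
  \<open>v = (b\<^sub>j\<^sub>1\<^sup>(\<^sup>s\<^sup>))\<close> are the displacements along \<open>X\<^sub>j + t v \<cdot> \<partial>\<^sub>y\<close> and \<open>v\<close>.
\<close>

lemma graph_shift_axis:
  fixes B :: "('k::finite, 'n::finite) matrices"
  shows "graph_shift B t a (h *\<^sub>R axis j 1, \<tau> *\<^sub>R (\<chi> s. B s $ Some j $ None)) =
    a + h *\<^sub>R (axis j 1, \<chi> s. 1/2 * (\<Sum>l\<in>UNIV. B s $ Some j $ Some l * fst a $ l)) +
      (h * t + \<tau>) *\<^sub>R (0, \<chi> s. B s $ Some j $ None)"
proof -
  have l: "layer1 (h *\<^sub>R axis j 1, y) = axis (Some j) h" for y :: "real ^ 'n"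
    by (auto simp: embW_def vec_eq_iff axis_def split: option.splits)
  have 1: "(B s *v p) \<bullet> axis (Some j) h = h * (B s *v p) $ Some j" for s p
    by (simp add: inner_axis mult.commute)
  have 2: "(B s *v axis None 1) $ Some j = B s $ Some j $ None" for s
    by (simp add: matrix_vector_mult_def axis_def if_distrib cong: if_cong)
  have 3: "(B s *v layer1 a) $ Some j = (\<Sum>l\<in>UNIV. B s $ Some j $ Some l * fst a $ l)" for s
    by (simp add: matrix_vector_mult_def UNIV_option_conv sum.reindex embW_def)
  show ?thesis
    unfolding graph_shift_def fst_conv snd_conv l 1 2 3
    by (simp add: prod_eq_iff vec_eq_iff algebra_simps)
qed

text \<open>
  The definite description in \<^const>\<open>intrinsic_gradient\<close> is well-defined: a coefficient
  vector exists by \<open>intrinsic_linear_form\<close>, and it is unique because the expansion can be tested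
  with small increments in each coordinate direction, which stay inside the open domain.
\<close>

lemma intrinsic_gradient_SomeD:
  fixes B :: "('k::finite, 'n::finite) matrices"
  assumes B: "carnot_step2 B" and U: "openin (top_of_set subW) U"
    and f: "\<And>a. embW a \<in> U \<Longrightarrow> f (embW a) = embV (\<phi> a)"
    and grad: "intrinsic_gradient eps B U f (embW a) = Some c"
  obtains l where "intrinsic_differential eps B U f (embW a) l"
    "\<And>x y. l (embW (x, y)) = embV (\<Sum>j\<in>UNIV. c $ j * x $ j)"
proof -
  have sub: "U \<subseteq> subW" using U openin_imp_subset by blast
  let ?P = "\<lambda>c. \<exists>l. intrinsic_differential eps B U f (embW a) l \<and>
    (\<forall>x y. l (embW (x, y)) = embV (\<Sum>j\<in>UNIV. c $ j * x $ j))"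
  have ex: "\<exists>l. intrinsic_differential eps B U f (embW a) l" and c: "c = (THE c. ?P c)"
    using grad by (auto simp: intrinsic_gradient_def split: if_splits)
  from ex obtain l where l: "intrinsic_differential eps B U f (embW a) l" by blast
  then have a: "embW a \<in> U" and "intrinsic_linear B l" by (auto simp: intrinsic_differential_def)
  obtain c0 where c0: "\<And>x y. l (embW (x, y)) = embV (\<Sum>j\<in>UNIV. c0 $ j * x $ j)"
    using intrinsic_linear_form[OF B \<open>intrinsic_linear B l\<close>] by blast
  have P0: "?P c0" using l c0 by blast
  have "c1 = c0" if P1: "?P c1" for c1
  proof -
    obtain l1 where l1: "intrinsic_differential eps B U f (embW a) l1"
      "\<And>x y. l1 (embW (x, y)) = embV (\<Sum>j\<in>UNIV. c1 $ j * x $ j)" using P1 by blast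
    show ?thesis
      unfolding vec_eq_iff
    proof
      fix j
      have "\<bar>c1 $ j - c0 $ j\<bar> \<le> 2 * \<eta>" if \<eta>: "\<eta> > 0" for \<eta>
      proof -
        define s where "s h = graph_shift B (\<phi> a) a (h *\<^sub>R axis j 1, 0)" for h
        have s_eq: "s h = a + h *\<^sub>R (axis j 1, \<chi> s. 1/2 * (\<Sum>l\<in>UNIV. B s $ Some j $ Some l * fst a $ l)) +
          (h * \<phi> a) *\<^sub>R (0, \<chi> s. B s $ Some j $ None)" for h
          using graph_shift_axis[of B "\<phi> a" a h j 0] by (simp add: s_def)
        obtain \<delta>0 where \<delta>0: "\<delta>0 > 0" "\<And>b. embW (graph_shift B (\<phi> a) a b) \<in> U \<Longrightarrow> 0 < hnorm eps (embW b :: ('k, 'n) carnot) \<Longrightarrow>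
          hnorm eps (embW b :: ('k, 'n) carnot) < \<delta>0 \<Longrightarrow>
          \<bar>\<phi> (graph_shift B (\<phi> a) a b) - \<phi> a - (\<Sum>j\<in>UNIV. c0 $ j * fst b $ j)\<bar> \<le> \<eta> * hnorm eps (embW b :: ('k, 'n) carnot)"
          using intrinsic_differential_estimate[OF B sub f l c0 \<eta>] by blast
        obtain \<delta>1 where \<delta>1: "\<delta>1 > 0" "\<And>b. embW (graph_shift B (\<phi> a) a b) \<in> U \<Longrightarrow> 0 < hnorm eps (embW b :: ('k, 'n) carnot) \<Longrightarrow>
          hnorm eps (embW b :: ('k, 'n) carnot) < \<delta>1 \<Longrightarrow>
          \<bar>\<phi> (graph_shift B (\<phi> a) a b) - \<phi> a - (\<Sum>j\<in>UNIV. c1 $ j * fst b $ j)\<bar> \<le> \<eta> * hnorm eps (embW b :: ('k, 'n) carnot)"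
          using intrinsic_differential_estimate[OF B sub f l1 \<eta>] by blast
        have "(s \<longlongrightarrow> a + 0 *\<^sub>R (axis j 1, \<chi> s. 1/2 * (\<Sum>l\<in>UNIV. B s $ Some j $ Some l * fst a $ l)) +
          (0 * \<phi> a) *\<^sub>R (0, \<chi> s. B s $ Some j $ None)) (at_right 0)"
          unfolding s_eq[abs_def] by (intro tendsto_intros)
        then have "(s \<longlongrightarrow> a) (at_right 0)" by (simp add: zero_prod_def[symmetric])
        then have "\<forall>\<^sub>F h in at_right 0. s h \<in> embW -` U"
          using open_vimage_embW[OF U] a by (auto dest!: topological_tendstoD)
        moreover have "\<forall>\<^sub>F h in at_right (0::real). h < min \<delta>0 \<delta>1"
          using eventually_at_right[of 0 1] \<delta>0(1) \<delta>1(1)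
          by (auto simp: eventually_at_right_field intro!: exI[of _ "min \<delta>0 \<delta>1"])
        moreover note eventually_at_right_less[of "0::real"]
        ultimately have "\<forall>\<^sub>F h in at_right (0::real). s h \<in> embW -` U \<and> h < min \<delta>0 \<delta>1 \<and> 0 < h"
          by eventually_elim auto
        then obtain h where h: "s h \<in> embW -` U" "h < \<delta>0" "h < \<delta>1" "0 < h"
          using eventually_happens[of _ "at_right (0::real)"] trivial_limit_at_right_real by auto
        define b where "b = (h *\<^sub>R axis j 1 :: real ^ 'k, 0 :: real ^ 'n)"
        have nb: "hnorm eps (embW b :: ('k, 'n) carnot) = h"
          using h by (simp add: hnorm_embW b_def)
        have sm: "(\<Sum>i\<in>UNIV. c' $ i * fst b $ i) = c' $ j * h" for c'
          by (simp add: b_def axis_def if_distrib cong: if_cong)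
        have U': "embW (graph_shift B (\<phi> a) a b) \<in> U" using h(1) by (simp add: s_def b_def)
        have "\<bar>(c1 $ j - c0 $ j) * h\<bar> \<le> 2 * \<eta> * h"
          using \<delta>0(2)[OF U'] \<delta>1(2)[OF U'] h unfolding nb sm by (simp add: algebra_simps abs_if split: if_splits)
        then show ?thesis using h(4) by (simp add: abs_mult)
      qed
      then have "\<bar>c1 $ j - c0 $ j\<bar> \<le> 0 + e" if "e > 0" for e
        using that by (metis add_0 field_sum_of_halves half_gt_zero mult_2)
      then show "c1 $ j = c0 $ j"
        using field_le_epsilon[of "\<bar>c1 $ j - c0 $ j\<bar>" 0] by simp
    qed
  qed
  then have "c = c0" unfolding c using P0 by (intro the_equality)
  with P0 that show ?thesis by blast
qed

section \<open>The intrinsic gradient as a distributional derivative\<close>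

lemma hnorm_embW_le:
  assumes "0 < eps" "eps \<le> 1"
  shows "hnorm eps (embW (h *\<^sub>R axis j 1, \<tau> *\<^sub>R v) :: ('k::finite, 'n::finite) carnot) \<le>
    (1 + sqrt (norm v)) * (\<bar>h\<bar> + sqrt \<bar>\<tau>\<bar>)"
proof -
  have "eps * sqrt (norm (\<tau> *\<^sub>R v)) \<le> sqrt (norm v) * sqrt \<bar>\<tau>\<bar>"
    using assms mult_right_mono[of eps 1 "sqrt (norm (\<tau> *\<^sub>R v))"]
    by (simp add: real_sqrt_mult mult.commute)
  moreover have "0 \<le> sqrt (norm v) * \<bar>h\<bar>" "0 \<le> sqrt (norm v) * sqrt \<bar>\<tau>\<bar>" by simp_all
  ultimately have "\<bar>h\<bar> \<le> (1 + sqrt (norm v)) * (\<bar>h\<bar> + sqrt \<bar>\<tau>\<bar>)"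
    "eps * sqrt (norm (\<tau> *\<^sub>R v)) \<le> (1 + sqrt (norm v)) * (\<bar>h\<bar> + sqrt \<bar>\<tau>\<bar>)"
    by (simp_all add: algebra_simps add_increasing add_increasing2)
  then show ?thesis
    by (simp add: hnorm_embW)
qed

lemma sqrt_modulus_small:
  assumes "(c::real) > 0" "\<delta> > 0"
  obtains \<delta>' where "\<delta>' > 0" "\<And>h \<tau>. 0 \<le> h \<Longrightarrow> h < \<delta>' \<Longrightarrow> \<bar>\<tau>\<bar> < \<delta>' \<Longrightarrow> c * (h + sqrt \<bar>\<tau>\<bar>) < \<delta>"
proof -
  \<comment> \<open>Both \<open>h\<close> and \<open>sqrt |\<tau>|\<close> stay below \<open>s\<close> when \<open>h\<close> and \<open>|\<tau>|\<close> are below \<open>s\<^sup>2 \<le> s\<close>.\<close>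
  define s where "s = min 1 (\<delta> / (2 * c))"
  have s: "0 < s" "s \<le> 1" "s \<le> \<delta> / (2 * c)"
    using assms by (auto simp: s_def)
  show ?thesis
  proof (rule that[of "s\<^sup>2"])
    show "0 < s\<^sup>2" using s by simp
    fix h \<tau> :: real assume h: "0 \<le> h" "h < s\<^sup>2" "\<bar>\<tau>\<bar> < s\<^sup>2"
    have "s\<^sup>2 \<le> s" using s by (simp add: power2_eq_square mult_left_le_one_le)
    moreover have "sqrt \<bar>\<tau>\<bar> < s"
      using h(3) s real_less_lsqrt by (simp add: real_less_lsqrt)
    ultimately have "h + sqrt \<bar>\<tau>\<bar> < 2 * s" using h by linarith
    then have "c * (h + sqrt \<bar>\<tau>\<bar>) < c * (2 * s)" using assms by simp
    also have "\<dots> \<le> \<delta>" using s(3) assms by (simp add: field_simps)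
    finally show "c * (h + sqrt \<bar>\<tau>\<bar>) < \<delta>" .
  qed
qed

text \<open>
  The function \<open>\<phi>\<close> is replaced by a bounded continuous extension \<open>\<psi>\<close> from a
  compact neighbourhood \<open>K'\<close> of the support of the test function, and \<open>burgers_weak_form\<close> is
  applied on a smaller neighbourhood \<open>K\<close> from which short displacements do not leave \<open>K'\<close>.
\<close>

lemma intrinsic_lipschitz_weak_derivative:
  fixes B :: "('k::finite, 'n::finite) matrices" and w :: "(real ^ 'k) \<times> (real ^ 'n) \<Rightarrow> real ^ 'k"
  assumes B: "carnot_step2 B" and eps: "0 < eps" "eps \<le> 1"
    and U: "openin (top_of_set subW) U"
    and lip: "locally_intrinsic_lipschitz eps B U f"
    and f: "\<And>a. embW a \<in> U \<Longrightarrow> f (embW a) = embV (\<phi> a)"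
    and w: "w \<in> borel_measurable (lebesgue_on (embW -` U))"
    and grad: "AE a in lebesgue_on (embW -` U). intrinsic_gradient eps B U f (embW a) = Some (w a)"
    and \<zeta>: "\<zeta> \<in> C1c (embW -` U)"
  shows "(LINT a|lebesgue_on (embW -` U).
           \<phi> a * (Xop B j \<zeta> a + (1/2) * \<phi> a * (\<Sum>s\<in>UNIV. B s $ Some j $ None * Yop s \<zeta> a)))
        = - (LINT a|lebesgue_on (embW -` U). w a $ j * \<zeta> a)"
proof -
  let ?O = "embW -` U :: ((real ^ 'k) \<times> (real ^ 'n)) set"
  have oO: "open ?O" by (rule open_vimage_embW[OF U])
  then have mO: "?O \<inter> space lebesgue \<in> sets lebesgue"
    using borel_open sets_completionI_sets[of ?O lborel] by simp
  have sub: "U \<subseteq> subW" using U openin_imp_subset by blast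
  define v :: "real ^ 'n" where "v = (\<chi> s. B s $ Some j $ None)"
  define A :: "real ^ 'k \<Rightarrow> real ^ 'n" where "A x = (\<chi> s. 1/2 * (\<Sum>l\<in>UNIV. B s $ Some j $ Some l * x $ l))" for x
  define D where "D a = frechet_derivative \<zeta> (at a)" for a
  have D: "(\<zeta> has_derivative D a) (at a)" for a
    using \<zeta> unfolding D_def C1c_def frechet_derivative_works by blast
  have cD: "continuous_on UNIV (\<lambda>a. D a x)" for x
    using \<zeta> unfolding D_def C1c_def by blast
  have "linear A"
    by (rule linearI) (simp_all add: A_def vec_eq_iff sum.distrib sum_distrib_left algebra_simps)
  then have A: "bounded_linear A" by (simp add: linear_conv_bounded_linear)
  have cA: "continuous_on UNIV A" by (rule linear_continuous_on[OF A])
  have shift: "graph_shift B t a (h *\<^sub>R axis j 1, \<tau> *\<^sub>R v) = a + h *\<^sub>R (axis j 1, A (fst a)) + (h * t + \<tau>) *\<^sub>R (0, v)" for t a h \<tau>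
    unfolding v_def A_def by (rule graph_shift_axis)
  have c\<phi>: "continuous_on ?O \<phi>"
    by (rule intrinsic_lipschitz_continuous[OF B U lip f])

  let ?S = "closure {a. \<zeta> a \<noteq> 0}"
  have S: "compact ?S" "?S \<subseteq> ?O" using \<zeta> by (simp_all add: C1c_def)
  obtain e where e: "e > 0" "(\<Union>x\<in>?S. cball x e) \<subseteq> ?O"
    using compact_subset_open_imp_cball_epsilon_subset[OF S(1) oO S(2)] by blast
  define d where "d = e / 2"
  have d: "d > 0" using e by (simp add: d_def)
  define K where "K = {x + y | x y. x \<in> ?S \<and> y \<in> cball 0 d}"
  define K' where "K' = {x + y | x y. x \<in> ?S \<and> y \<in> cball 0 e}"
  have K: "compact K" and K': "compact K'"
    unfolding K_def K'_def by (intro compact_sums S compact_cball)+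
  have K'O: "K' \<subseteq> ?O"
  proof
    fix z assume "z \<in> K'"
    then obtain x y where "z = x + y" "x \<in> ?S" "norm y \<le> e" by (auto simp: K'_def)
    then have "z \<in> (\<Union>x\<in>?S. cball x e)" by (intro UN_I[of x]) (auto simp: dist_norm)
    with e show "z \<in> ?O" by blast
  qed
  have near: "b \<in> K'" if aK: "a \<in> K" and ba: "norm (b - a) \<le> d" for a b
  proof -
    obtain x y where xy: "a = x + y" "x \<in> ?S" "norm y \<le> d" using aK unfolding K_def mem_Collect_eq mem_cball_0 by blast
    have "b = x + (y + (b - a))" using xy by simp
    moreover have "norm (y + (b - a)) \<le> e"
      using norm_triangle_ineq[of y "b - a"] xy ba by (simp add: d_def)
    ultimately show ?thesis unfolding K'_def using xy(2) mem_cball_0 by blast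
  qed
  have KK': "K \<subseteq> K'"
  proof
    fix a assume "a \<in> K"
    from near[OF this, of a] d show "a \<in> K'" by simp
  qed
  then have KO: "K \<subseteq> ?O" using K'O by blast
  have supp: "a \<in> K" if "\<zeta> b \<noteq> 0" "norm (b - a) \<le> d" for a b
  proof -
    have "b \<in> ?S" using that(1) closure_subset[of "{a. \<zeta> a \<noteq> 0}"] by blast
    moreover have "a = b + (a - b)" by simp
    moreover have "a - b \<in> cball 0 d" using that(2) by (simp add: norm_minus_commute)
    ultimately show ?thesis unfolding K_def by blast
  qed
  have DK: "D a x = 0" if "a \<notin> K" for a x
  proof (rule C1_compact_support_Lipschitz(2)[OF D cD])
    show "bounded {a. \<zeta> a \<noteq> 0}"
      using bounded_subset[OF compact_imp_bounded[OF S(1)] closure_subset] .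
    show "a \<notin> ?S"
    proof
      assume "a \<in> ?S"
      moreover have "a = a + 0" "0 \<in> cball 0 d" using d by simp_all
      ultimately have "a \<in> K" unfolding K_def by blast
      with that show False by simp
    qed
  qed

  have "compact (\<phi> ` K')" by (rule compact_continuous_image[OF continuous_on_subset[OF c\<phi> K'O] K'])
  then obtain M where M: "\<And>a. a \<in> K' \<Longrightarrow> norm (\<phi> a) \<le> M"
    unfolding bounded_iff using compact_imp_bounded[of "\<phi> ` K'"] by (auto simp: bounded_iff)
  have M': "norm (\<phi> a) \<le> max M 0" if "a \<in> K'" for a
    using M[OF that] by simp
  have "closedin (top_of_set UNIV) K'" using K' by (simp add: compact_imp_closed)
  then obtain \<psi> where \<psi>: "continuous_on UNIV \<psi>" "\<And>a. a \<in> K' \<Longrightarrow> \<psi> a = \<phi> a" "\<And>a. norm (\<psi> a) \<le> max M 0"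
    using Tietze[OF continuous_on_subset[OF c\<phi> K'O] _ max.cobounded2 M', of UNIV] by (metis UNIV_I)

  obtain C \<delta>0 where C: "C \<ge> 0" "\<delta>0 > 0"
    "\<And>a b. a \<in> K \<Longrightarrow> dist a (graph_shift B (\<phi> a) a b) < \<delta>0 \<Longrightarrow>
      \<bar>\<phi> (graph_shift B (\<phi> a) a b) - \<phi> a\<bar> \<le> C * hnorm eps (embW b :: ('k, 'n) carnot)"
    using intrinsic_lipschitz_uniform_on_compact[OF B U lip f K KO] by blast
  define c where "c = 1 + sqrt (norm v)"
  have c: "c > 0" by (simp add: c_def add_pos_nonneg)
  have hb: "hnorm eps (embW (h *\<^sub>R axis j 1, \<tau> *\<^sub>R v) :: ('k, 'n) carnot) \<le> c * (h + sqrt \<bar>\<tau>\<bar>)" if "h \<ge> 0" for h \<tau>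
    using hnorm_embW_le[OF eps, of h j \<tau> v] that by (simp add: c_def)

  have "\<exists>Q>0. \<forall>a\<in>K. norm (axis j 1 :: real ^ 'k, A (fst a)) + \<bar>\<phi> a\<bar> * norm v + norm v \<le> Q"
  proof -
    have "continuous_on K (\<lambda>a. norm (axis j 1 :: real ^ 'k, A (fst a)) + \<bar>\<phi> a\<bar> * norm v + norm v)"
      by (intro continuous_intros continuous_on_compose2[OF cA] continuous_on_subset[OF c\<phi> KO]) auto
    from compact_continuous_image[OF this K] obtain Q where
      Q: "\<forall>a\<in>K. norm (norm (axis j 1 :: real ^ 'k, A (fst a)) + \<bar>\<phi> a\<bar> * norm v + norm v) \<le> Q"
      by (auto dest!: compact_imp_bounded simp: bounded_iff)
    show ?thesis by (rule exI[of _ "max Q 1"]) (use Q in force)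
  qed
  then obtain Q where Q: "Q > 0" "\<And>a. a \<in> K \<Longrightarrow> norm (axis j 1 :: real ^ 'k, A (fst a)) + \<bar>\<phi> a\<bar> * norm v + norm v \<le> Q" by blast
  have disp: "norm (graph_shift B (\<phi> a) a (h *\<^sub>R axis j 1, \<tau> *\<^sub>R v) - a) \<le> r * Q"
    if "a \<in> K" "0 \<le> h" "h \<le> r" "\<bar>\<tau>\<bar> \<le> r" for a h \<tau> r
  proof -
    have "norm (graph_shift B (\<phi> a) a (h *\<^sub>R axis j 1, \<tau> *\<^sub>R v) - a) =
        norm (h *\<^sub>R (axis j 1 :: real ^ 'k, A (fst a)) + (h * \<phi> a + \<tau>) *\<^sub>R (0 :: real ^ 'k, v))"
      unfolding shift by (simp add: add.assoc)
    also have "\<dots> \<le> h * norm (axis j 1 :: real ^ 'k, A (fst a)) + \<bar>h * \<phi> a + \<tau>\<bar> * norm v"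
      using norm_triangle_ineq[of "h *\<^sub>R (axis j 1 :: real ^ 'k, A (fst a))" "(h * \<phi> a + \<tau>) *\<^sub>R (0 :: real ^ 'k, v)"] that(2)
      unfolding norm_scaleR norm_Pair2 by simp
    also have "\<bar>h * \<phi> a + \<tau>\<bar> \<le> h * \<bar>\<phi> a\<bar> + \<bar>\<tau>\<bar>"
      using abs_triangle_ineq[of "h * \<phi> a" \<tau>] that(2) by (simp add: abs_mult)
    also have "h * norm (axis j 1 :: real ^ 'k, A (fst a)) + (h * \<bar>\<phi> a\<bar> + \<bar>\<tau>\<bar>) * norm v
        \<le> r * norm (axis j 1 :: real ^ 'k, A (fst a)) + (r * \<bar>\<phi> a\<bar> + r) * norm v"
      using that by (intro add_mono mult_right_mono) auto
    also have "\<dots> = r * (norm (axis j 1 :: real ^ 'k, A (fst a)) + \<bar>\<phi> a\<bar> * norm v + norm v)"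
      by (simp add: algebra_simps)
    also have "\<dots> \<le> r * Q" using Q(2)[OF that(1)] that by (intro mult_left_mono) auto
    finally show ?thesis by (simp add: mult_right_mono)
  qed
  define \<rho> where "\<rho> = min d (\<delta>0 / 2) / Q"
  have \<rho>: "\<rho> > 0" "\<rho> * Q \<le> d" "\<rho> * Q < \<delta>0"
    using Q(1) d C(2) by (auto simp: \<rho>_def)
  have inK': "graph_shift B (\<phi> a) a (h *\<^sub>R axis j 1, \<tau> *\<^sub>R v) \<in> K'" if "a \<in> K" "0 \<le> h" "h \<le> \<rho>" "\<bar>\<tau>\<bar> \<le> \<rho>" for a h \<tau>
    using disp[OF that] \<rho>(2) by (intro near[OF that(1)]) linarith

  define w' where "w' a = indicator ?O a *\<^sub>R (w a $ j)" for a
  have "(\<integral>a. \<psi> a * (D a (axis j 1, A (fst a)) + \<psi> a / 2 * D a (0, v)) \<partial>lebesgue) =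
      - (\<integral>a. w' a * \<zeta> a \<partial>lebesgue)"
  proof (rule burgers_weak_form[OF A \<psi>(1) _ K d supp D cD _ \<rho>(1), where C = "C * c" and M = "max M 0"])
    show "\<bar>\<psi> a\<bar> \<le> max M 0" for a using \<psi>(3)[of a] by simp
    have "(\<lambda>x :: real ^ 'k. x $ j) \<in> borel_measurable borel"
      by (intro borel_measurable_continuous_onI continuous_intros)
    from measurable_compose[OF w this]
    have "(\<lambda>a. w a $ j) \<in> borel_measurable (lebesgue_on ?O)" .
    then show "w' \<in> borel_measurable lebesgue"
      unfolding w'_def by (rule borel_measurable_restrict_space_iff[OF mO, THEN iffD1])
    show "0 \<le> C * c" using C c by simp
  next
    fix a h \<tau> assume a: "a \<in> K" and h: "0 \<le> h" "h \<le> \<rho>" "\<bar>\<tau>\<bar> \<le> \<rho>"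
    have \<psi>a: "\<psi> a = \<phi> a" using \<psi>(2) KK' a by blast
    let ?b = "(h *\<^sub>R axis j 1 :: real ^ 'k, \<tau> *\<^sub>R v)"
    have "dist a (graph_shift B (\<phi> a) a ?b) < \<delta>0"
      using disp[OF a h] \<rho>(3) by (simp add: dist_norm norm_minus_commute)
    from C(3)[OF a this] have "\<bar>\<phi> (graph_shift B (\<phi> a) a ?b) - \<phi> a\<bar> \<le> C * hnorm eps (embW ?b :: ('k, 'n) carnot)" .
    also have "\<dots> \<le> C * (c * (h + sqrt \<bar>\<tau>\<bar>))"
      by (intro mult_left_mono hb h C)
    finally show "\<bar>\<psi> (a + h *\<^sub>R (axis j 1, A (fst a)) + (h * \<psi> a + \<tau>) *\<^sub>R (0, v)) - \<psi> a\<bar> \<le> C * c * (h + sqrt \<bar>\<tau>\<bar>)"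
      unfolding \<psi>a shift[symmetric] \<psi>(2)[OF inK'[OF a h]] by (simp add: mult.assoc)
  next
    have "AE a in lebesgue. a \<in> ?O \<longrightarrow> intrinsic_gradient eps B U f (embW a) = Some (w a)"
      using grad unfolding AE_restrict_space_iff[OF mO] .
    then show "AE a in lebesgue. a \<in> K \<longrightarrow> (\<forall>\<eta>>0. \<exists>\<delta>>0. \<forall>h \<tau>. 0 \<le> h \<and> h < \<delta> \<and> \<bar>\<tau>\<bar> < \<delta> \<longrightarrow>
      \<bar>\<psi> (a + h *\<^sub>R (axis j 1, A (fst a)) + (h * \<psi> a + \<tau>) *\<^sub>R (0, v)) - \<psi> a - w' a * h\<bar> \<le> \<eta> * (h + sqrt \<bar>\<tau>\<bar>))"
    proof eventually_elim
      case (elim a)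
      show ?case
      proof (intro impI allI)
        fix \<eta> :: real assume a: "a \<in> K" and \<eta>: "\<eta> > 0"
        have \<psi>a: "\<psi> a = \<phi> a" using \<psi>(2) KK' a by blast
        have w'a: "w' a = w a $ j" using a KO by (auto simp: w'_def)
        have "intrinsic_gradient eps B U f (embW a) = Some (w a)" using elim a KO by blast
        from intrinsic_gradient_SomeD[OF B U f this] obtain l where
          l: "intrinsic_differential eps B U f (embW a) l"
            "\<And>x y. l (embW (x, y)) = embV (\<Sum>j\<in>UNIV. w a $ j * x $ j)" by blast
        have "\<eta> / c > 0" using \<eta> c by simp
        from intrinsic_differential_estimate[OF B sub f l this] obtain \<delta> where \<delta>: "\<delta> > 0"
          "\<And>b. embW (graph_shift B (\<phi> a) a b) \<in> U \<Longrightarrow> 0 < hnorm eps (embW b :: ('k, 'n) carnot) \<Longrightarrow>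
            hnorm eps (embW b :: ('k, 'n) carnot) < \<delta> \<Longrightarrow>
            \<bar>\<phi> (graph_shift B (\<phi> a) a b) - \<phi> a - (\<Sum>j\<in>UNIV. w a $ j * fst b $ j)\<bar> \<le> \<eta> / c * hnorm eps (embW b :: ('k, 'n) carnot)"
          by blast
        obtain \<delta>' where \<delta>': "\<delta>' > 0" "\<And>h \<tau>. 0 \<le> h \<Longrightarrow> h < \<delta>' \<Longrightarrow> \<bar>\<tau>\<bar> < \<delta>' \<Longrightarrow> c * (h + sqrt \<bar>\<tau>\<bar>) < \<delta>"
          using sqrt_modulus_small[OF c \<delta>(1)] by blast
        show "\<exists>\<delta>>0. \<forall>h \<tau>. 0 \<le> h \<and> h < \<delta> \<and> \<bar>\<tau>\<bar> < \<delta> \<longrightarrow>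
          \<bar>\<psi> (a + h *\<^sub>R (axis j 1, A (fst a)) + (h * \<psi> a + \<tau>) *\<^sub>R (0, v)) - \<psi> a - w' a * h\<bar> \<le> \<eta> * (h + sqrt \<bar>\<tau>\<bar>)"
        proof (intro exI[of _ "min \<delta>' \<rho>"] conjI allI impI)
          show "0 < min \<delta>' \<rho>" using \<delta>'(1) \<rho>(1) by simp
          fix h \<tau> assume "0 \<le> h \<and> h < min \<delta>' \<rho> \<and> \<bar>\<tau>\<bar> < min \<delta>' \<rho>"
          then have h: "0 \<le> h" "h \<le> \<rho>" "\<bar>\<tau>\<bar> \<le> \<rho>" and h': "h < \<delta>'" "\<bar>\<tau>\<bar> < \<delta>'" by auto
          let ?b = "(h *\<^sub>R axis j 1 :: real ^ 'k, \<tau> *\<^sub>R v)"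
          let ?n = "hnorm eps (embW ?b :: ('k, 'n) carnot)"
          have sm: "(\<Sum>i\<in>UNIV. w a $ i * fst ?b $ i) = w a $ j * h"
            by (simp add: axis_def if_distrib cong: if_cong)
          have "\<bar>\<phi> (graph_shift B (\<phi> a) a ?b) - \<phi> a - w a $ j * h\<bar> \<le> \<eta> / c * ?n"
          proof (cases "0 < ?n")
            case True
            have "?n < \<delta>" using hb[OF h(1), of \<tau>] \<delta>'(2)[OF h(1) h'] by linarith
            moreover have "embW (graph_shift B (\<phi> a) a ?b) \<in> U" using inK'[OF a h] K'O by blast
            ultimately show ?thesis using \<delta>(2)[of ?b] True unfolding sm by blast
          next
            case False
            then have "norm (h *\<^sub>R axis j 1 :: real ^ 'k) \<le> 0" "eps * sqrt (norm (\<tau> *\<^sub>R v)) \<le> 0"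
              unfolding hnorm_embW by simp_all
            then have z: "h = 0" "\<tau> *\<^sub>R v = 0"
              using eps by (auto simp: mult_le_0_iff axis_eq_0_iff)
            have shift_a: "graph_shift B (\<phi> a) a ?b = a"
              unfolding shift using z by (simp add: prod_eq_iff)
            have "0 \<le> ?n" by (simp add: hnorm_def le_max_iff_disj)
            then show ?thesis unfolding shift_a using z(1) \<eta> c by simp
          qed
          also have "\<dots> \<le> \<eta> / c * (c * (h + sqrt \<bar>\<tau>\<bar>))"
            using hb[OF h(1), of \<tau>] \<eta> c by (intro mult_left_mono) auto
          also have "\<dots> = \<eta> * (h + sqrt \<bar>\<tau>\<bar>)" using c by simp
          finally show "\<bar>\<psi> (a + h *\<^sub>R (axis j 1, A (fst a)) + (h * \<psi> a + \<tau>) *\<^sub>R (0, v)) - \<psi> a - w' a * h\<bar> \<le> \<eta> * (h + sqrt \<bar>\<tau>\<bar>)"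
            unfolding \<psi>a w'a shift[symmetric] \<psi>(2)[OF inK'[OF a h]] .
        qed
      qed
    qed
  qed
  moreover have "(LINT a|lebesgue_on ?O.
      \<phi> a * (Xop B j \<zeta> a + (1/2) * \<phi> a * (\<Sum>s\<in>UNIV. B s $ Some j $ None * Yop s \<zeta> a))) =
    (\<integral>a. \<psi> a * (D a (axis j 1, A (fst a)) + \<psi> a / 2 * D a (0, v)) \<partial>lebesgue)"
    unfolding integral_restrict_space[OF mO]
  proof (rule Bochner_Integration.integral_cong[OF refl])
    fix a
    have lin: "linear (D a)" using D has_derivative_linear by blast
    have vert: "D a (0, y) = (\<Sum>s\<in>UNIV. y $ s * Yop s \<zeta> a)" for y :: "real ^ 'n"
    proof -
      have "(0, y) = (\<Sum>s\<in>UNIV. y $ s *\<^sub>R (0 :: real ^ 'k, axis s 1 :: real ^ 'n))"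
        by (simp add: prod_eq_iff fst_sum snd_sum vec_eq_iff axis_def if_distrib cong: if_cong)
      then have "D a (0, y) = D a (\<Sum>s\<in>UNIV. y $ s *\<^sub>R (0 :: real ^ 'k, axis s 1 :: real ^ 'n))" by simp
      also have "\<dots> = (\<Sum>s\<in>UNIV. y $ s * D a (0, axis s 1))"
        by (simp add: linear_sum[OF lin] linear_scale[OF lin] del: scaleR_Pair)
      finally show ?thesis by (simp add: D_def Yop_def)
    qed
    have v': "D a (0, v) = (\<Sum>s\<in>UNIV. B s $ Some j $ None * Yop s \<zeta> a)"
      by (simp add: vert v_def)
    have X': "D a (axis j 1, A (fst a)) = Xop B j \<zeta> a"
    proof -
      have "D a (axis j 1, A (fst a)) = D a (axis j 1, 0) + D a (0, A (fst a))"
        using linear_add[OF lin, of "(axis j 1, 0)" "(0, A (fst a))"] by simp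
      also have "D a (0, A (fst a)) = (1/2) * (\<Sum>s\<in>UNIV. \<Sum>l\<in>UNIV. B s $ Some j $ Some l * fst a $ l * Yop s \<zeta> a)"
        by (simp add: vert A_def sum_distrib_left sum_distrib_right mult_ac)
      finally show ?thesis by (simp add: Xop_def D_def)
    qed
    show "indicator ?O a *\<^sub>R (\<phi> a * (Xop B j \<zeta> a + (1/2) * \<phi> a * (\<Sum>s\<in>UNIV. B s $ Some j $ None * Yop s \<zeta> a))) =
      \<psi> a * (D a (axis j 1, A (fst a)) + \<psi> a / 2 * D a (0, v))"
    proof (cases "a \<in> K")
      case True
      then have "a \<in> ?O" "\<psi> a = \<phi> a" using KO KK' \<psi>(2) by blast+
      then show ?thesis by (simp add: v' X')
    next
      case False
      then show ?thesis by (simp add: v'[symmetric] X'[symmetric] DK)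
    qed
  qed
  moreover have "(LINT a|lebesgue_on ?O. w a $ j * \<zeta> a) = (\<integral>a. w' a * \<zeta> a \<partial>lebesgue)"
    unfolding integral_restrict_space[OF mO] by (simp add: w'_def mult.assoc)
  ultimately show ?thesis by simp
qed

theorem theorem7p1:
  fixes B :: "('k::finite, 'n::finite) matrices"
    and eps :: real
    and Ohat :: "('k, 'n) carnot set"
    and phihat :: "('k, 'n) carnot \<Rightarrow> ('k, 'n) carnot"
    and \<O> :: "((real ^ 'k) \<times> (real ^ 'n)) set"
    and \<phi> :: "(real ^ 'k) \<times> (real ^ 'n) \<Rightarrow> real"
  assumes "carnot_step2 B"
    and "0 < eps" "eps \<le> 1"
    and "\<And>p q :: ('k, 'n) carnot. hnorm eps (gmul B p q) \<le> hnorm eps p + hnorm eps q"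
    and "openin (top_of_set subW) Ohat"
    and "phihat ` Ohat \<subseteq> subV"
    and "locally_intrinsic_lipschitz eps B Ohat phihat"
    and "\<O> = embW -` Ohat"
    and "\<And>a. a \<in> \<O> \<Longrightarrow> phihat (embW a) = embV (\<phi> a)"
    and "Linf_loc_ae \<O> (\<lambda>a. intrinsic_gradient eps B Ohat phihat (embW a))"
  shows "\<exists>w. Linf_loc \<O> w \<and>
           (AE a in lebesgue_on \<O>. intrinsic_gradient eps B Ohat phihat (embW a) = Some (w a)) \<and>
           distributional_solution B \<O> \<phi> w"
proof -
  have f: "phihat (embW a) = embV (\<phi> a)" if "embW a \<in> Ohat" for a
    using assms(8,9) that by blast
  from assms(10) obtain w where w: "Linf_loc \<O> w"
    "AE a in lebesgue_on \<O>. intrinsic_gradient eps B Ohat phihat (embW a) = Some (w a)"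
    unfolding Linf_loc_ae_def by blast
  have "continuous_on \<O> \<phi>"
    using intrinsic_lipschitz_continuous[OF assms(1,5,7) f] by (simp add: assms(8))
  moreover have "(LINT a|lebesgue_on \<O>.
      \<phi> a * (Xop B j \<zeta> a + (1/2) * \<phi> a * (\<Sum>s\<in>UNIV. B s $ Some j $ None * Yop s \<zeta> a)))
      = - (LINT a|lebesgue_on \<O>. w a $ j * \<zeta> a)" if "\<zeta> \<in> C1c \<O>" for \<zeta> j
    using w that unfolding assms(8) Linf_loc_def
    by (intro intrinsic_lipschitz_weak_derivative[OF assms(1,2,3,5,7) f]) auto
  ultimately have "distributional_solution B \<O> \<phi> w"
    unfolding distributional_solution_def using w(1) by blast
  with w show ?thesis by blast
qed

end
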